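(* Let $m>0$ and let $\widehat{\mathbb C^2}$ be the blow-up of $\mathbb C^2$ at $0$, with its standard complex structure $J$. Then $\widehat{\mathbb C^2}$ with the Burns metric is a QCH Kähler surface of Calabi type.
   Context: Burns metric: on $\mathbb C^2\setminus\{0\}$ consider the Kähler metric $g$ with Kähler form $$\omega=i\,\partial\bar\partial\big(\|z\|^2+m\ln\|z\|^2\big),\qquad \omega(X,Y)=g(JX,Y),\qquad \|z\|^2=|z_1|^2+|z_2|^2,$$ where $m>0$ is a constant. This metric extends smoothly to a Kähler metric on the blow-up $\widehat{\mathbb C^2}$ of $\mathbb C^2$ at the origin; the extension is the Burns metric. QCH Kähler surface: a Kähler surface $(N,g,J)$ (real dimension 4) admitting a global 2-dimensional $J$-invariant distribution $\mathcal D\subset TN$ such that, for every $p\in N$ and every $J$-invariant 2-plane $\pi\subset T_pN$ with $X\in\pi$, $g(X,X)=1$, the holomorphic curvature $K(\pi)=R(X,JX,JX,X)$ depends only on the point $p$ and the number $|X_{\mathcal D}|=\sqrt{g(X_{\mathcal D},X_{\mathcal D})}$, where $X_{\mathcal D}$ is the orthogonal projection of $X$ onto $\mathcal D$. Its opposite almost Hermitian structure $I$ is the $g$-orthogonal almost complex structure with $I=J$ on $\mathcal D$ and $I=-J$ on $\mathcal D^\perp$ (defined up to sign); its Kähler form $\omega_I(X,Y)=g(IX,Y)$ is anti-selfdual for the orientation of $J$. When $I$ is integrable, its Lee form $\theta$ is defined by $d\omega_I=2\theta\wedge\omega_I$. Calabi type Kähler surface: a QCH Kähler surface such that $I$ is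 integrable (Hermitian), $|\nabla I|>0$ everywhere, one of the distributions $\mathcal D,\mathcal D^\perp$ coincides with $\mathcal D_0=\operatorname{span}\{\theta^\sharp,I\theta^\sharp\}=\{X:\nabla_XI=0\}$ ("generalized Calabi type"), and in addition $(g,I)$ is locally conformally Kähler. A QCH Kähler surface $(N,g,J)$ is said to be of Calabi type if there is an open dense subset $U\subset N$ such that $(U,g|_U,J|_U)$ is a Calabi type Kähler surface in this sense. *)

theory Defs
  imports "HOL-Analysis.Analysis"
begin

subsection \<open>Smooth maps on open subsets of a Euclidean space\<close>

primrec Ck_on :: "nat \<Rightarrow> ('a::real_normed_vector \<Rightarrow> 'b::real_normed_vector) \<Rightarrow> 'a set \<Rightarrow> bool" where
  "Ck_on 0 f S \<longleftrightarrow> continuous_on S f"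
| "Ck_on (Suc k) f S \<longleftrightarrow>
     (\<forall>x\<in>S. f differentiable (at x)) \<and> (\<forall>v. Ck_on k (\<lambda>x. frechet_derivative f (at x) v) S)"

definition smooth_on :: "'a set \<Rightarrow> ('a::real_normed_vector \<Rightarrow> 'b::real_normed_vector) \<Rightarrow> bool" where
  "smooth_on S f \<longleftrightarrow> (\<forall>k. Ck_on k f S)"

definition pderivative :: "('a::real_normed_vector \<Rightarrow> 'b::real_normed_vector) \<Rightarrow> 'a \<Rightarrow> 'a \<Rightarrow> 'b" where
  "pderivative f x u = frechet_derivative f (at x) u"


subsection \<open>Tensor calculus in one chart\<close>

text \<open>On an open subset of a Euclidean space \<open>'e\<close> every tangent space is \<open>'e\<close>.  Fields are
  functions of the base point (first argument); a fixed vector \<open>u\<close> also denotes the constant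
  (coordinate) vector field with value \<open>u\<close>, and constant vector fields commute.\<close>

type_synonym 'e bilin = "'e \<Rightarrow> 'e \<Rightarrow> 'e \<Rightarrow> real"
type_synonym 'e endo = "'e \<Rightarrow> 'e \<Rightarrow> 'e"

definition lie_bracket :: "('e::real_normed_vector \<Rightarrow> 'e) \<Rightarrow> ('e \<Rightarrow> 'e) \<Rightarrow> 'e \<Rightarrow> 'e" where
  "lie_bracket X Y x = pderivative Y x (X x) - pderivative X x (Y x)"

definition nijenhuis :: "('e::real_normed_vector) endo \<Rightarrow> 'e \<Rightarrow> 'e \<Rightarrow> 'e \<Rightarrow> 'e" where
  "nijenhuis J x u v =
     lie_bracket (\<lambda>y. J y u) (\<lambda>y. J y v) x
     - J x (lie_bracket (\<lambda>y. J y u) (\<lambda>y. v) x)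
     - J x (lie_bracket (\<lambda>y. u) (\<lambda>y. J y v) x)
     - lie_bracket (\<lambda>y. u) (\<lambda>y. v) x"

text \<open>The exterior derivative of a 2-form and the wedge product of a 1-form with a 2-form, both
  in the normalisation without factorials (\<open>d\<alpha>(X,Y) = X \<alpha>(Y) - Y \<alpha>(X) - \<alpha>([X,Y])\<close>,
  \<open>(\<alpha> \<and> \<beta>)(X,Y) = \<alpha>(X) \<beta>(Y) - \<alpha>(Y) \<beta>(X)\<close>).\<close>

definition ext_deriv2 :: "('e::real_normed_vector) bilin \<Rightarrow> 'e \<Rightarrow> 'e \<Rightarrow> 'e \<Rightarrow> 'e \<Rightarrow> real" where
  "ext_deriv2 \<omega> x u v w =
     pderivative (\<lambda>y. \<omega> y v w) x u - pderivative (\<lambda>y. \<omega> y u w) x v + pderivative (\<lambda>y. \<omega> y u v) x w"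

definition wedge12 :: "('e \<Rightarrow> real) \<Rightarrow> ('e \<Rightarrow> 'e \<Rightarrow> real) \<Rightarrow> 'e \<Rightarrow> 'e \<Rightarrow> 'e \<Rightarrow> real" where
  "wedge12 \<alpha> \<beta> u v w = \<alpha> u * \<beta> v w - \<alpha> v * \<beta> u w + \<alpha> w * \<beta> u v"

definition riemannian_on :: "('e::euclidean_space) set \<Rightarrow> 'e bilin \<Rightarrow> bool" where
  "riemannian_on S g \<longleftrightarrow>
     (\<forall>u v. smooth_on S (\<lambda>x. g x u v)) \<and>
     (\<forall>x\<in>S. (\<forall>u. linear (g x u)) \<and> (\<forall>u v. g x u v = g x v u) \<and> (\<forall>u. u \<noteq> 0 \<longrightarrow> g x u u > 0))"

definition almost_complex_on :: "('e::euclidean_space) set \<Rightarrow> 'e endo \<Rightarrow> bool" where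
  "almost_complex_on S J \<longleftrightarrow>
     (\<forall>u. smooth_on S (\<lambda>x. J x u)) \<and> (\<forall>x\<in>S. linear (J x) \<and> (\<forall>u. J x (J x u) = - u))"

definition kform :: "'e bilin \<Rightarrow> 'e endo \<Rightarrow> 'e bilin" where
  "kform g J x u v = g x (J x u) v"

definition hermitian_on :: "('e::euclidean_space) set \<Rightarrow> 'e bilin \<Rightarrow> 'e endo \<Rightarrow> bool" where
  "hermitian_on S g J \<longleftrightarrow>
     riemannian_on S g \<and> almost_complex_on S J \<and>
     (\<forall>x\<in>S. \<forall>u v. g x (J x u) (J x v) = g x u v) \<and>
     (\<forall>x\<in>S. \<forall>u v. nijenhuis J x u v = 0)"

definition kahler_on :: "('e::euclidean_space) set \<Rightarrow> 'e bilin \<Rightarrow> 'e endo \<Rightarrow> bool" where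
  "kahler_on S g J \<longleftrightarrow>
     hermitian_on S g J \<and> (\<forall>x\<in>S. \<forall>u v w. ext_deriv2 (kform g J) x u v w = 0)"

text \<open>\<open>christoffel g x u v\<close> is \<open>\<nabla>\<^sub>u v\<close> for the coordinate fields \<open>u\<close>, \<open>v\<close>, determined by
  Koszul's formula (the bracket terms vanish).\<close>

definition christoffel :: "('e::euclidean_space) bilin \<Rightarrow> 'e \<Rightarrow> 'e \<Rightarrow> 'e \<Rightarrow> 'e" where
  "christoffel g x u v = (THE c. \<forall>w. 2 * g x c w =
     pderivative (\<lambda>y. g y v w) x u + pderivative (\<lambda>y. g y u w) x v - pderivative (\<lambda>y. g y u v) x w)"

definition cov_deriv :: "('e::euclidean_space) bilin \<Rightarrow> 'e \<Rightarrow> 'e \<Rightarrow> ('e \<Rightarrow> 'e) \<Rightarrow> 'e" where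
  "cov_deriv g x u Y = pderivative Y x u + christoffel g x u (Y x)"

text \<open>\<open>R(u,v)w = \<nabla>\<^sub>u \<nabla>\<^sub>v w - \<nabla>\<^sub>v \<nabla>\<^sub>u w - \<nabla>\<^bsub>[u,v]\<^esub> w\<close>, with \<open>[u,v] = 0\<close> for coordinate fields.\<close>

definition riem_curv :: "('e::euclidean_space) bilin \<Rightarrow> 'e \<Rightarrow> 'e \<Rightarrow> 'e \<Rightarrow> 'e \<Rightarrow> 'e" where
  "riem_curv g x u v w =
     cov_deriv g x u (\<lambda>y. cov_deriv g y v (\<lambda>_. w)) - cov_deriv g x v (\<lambda>y. cov_deriv g y u (\<lambda>_. w))"

definition hol_curv :: "('e::euclidean_space) bilin \<Rightarrow> 'e endo \<Rightarrow> 'e \<Rightarrow> 'e \<Rightarrow> real" where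
  "hol_curv g J x u = g x (riem_curv g x u (J x u) (J x u)) u"

text \<open>\<open>(\<nabla>\<^sub>u I) v = \<nabla>\<^sub>u (I v) - I (\<nabla>\<^sub>u v)\<close>\<close>

definition cov_deriv_endo :: "('e::euclidean_space) bilin \<Rightarrow> 'e endo \<Rightarrow> 'e \<Rightarrow> 'e \<Rightarrow> 'e \<Rightarrow> 'e" where
  "cov_deriv_endo g I x u v = cov_deriv g x u (\<lambda>y. I y v) - I x (cov_deriv g x u (\<lambda>_. v))"

definition orthonormal_basis :: "('e::euclidean_space \<Rightarrow> 'e \<Rightarrow> real) \<Rightarrow> 'e set \<Rightarrow> bool" where
  "orthonormal_basis h B \<longleftrightarrow>
     card B = DIM('e) \<and> (\<forall>b\<in>B. \<forall>c\<in>B. h b c = (if b = c then 1 else 0))"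

text \<open>The pointwise norm \<open>|\<nabla>I|\<close>; it does not depend on the orthonormal basis.\<close>

definition norm_cov_deriv_endo :: "('e::euclidean_space) bilin \<Rightarrow> 'e endo \<Rightarrow> 'e \<Rightarrow> real" where
  "norm_cov_deriv_endo g I x =
     (let B = (SOME B. orthonormal_basis (g x) B) in
      sqrt (\<Sum>b\<in>B. \<Sum>c\<in>B. g x (cov_deriv_endo g I x b c) (cov_deriv_endo g I x b c)))"

text \<open>For a nondegenerate \<open>\<omega>\<^sub>I\<close> in real dimension 4, \<open>\<theta> \<mapsto> \<theta> \<and> \<omega>\<^sub>I\<close> is bijective from covectors to
  3-forms, so the Lee form is well defined.\<close>

definition lee_form :: "('e::euclidean_space) bilin \<Rightarrow> 'e endo \<Rightarrow> 'e \<Rightarrow> 'e \<Rightarrow> real" where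
  "lee_form g I x = (THE \<theta>. linear \<theta> \<and>
     (\<forall>u v w. ext_deriv2 (kform g I) x u v w = 2 * wedge12 \<theta> (kform g I x) u v w))"

definition sharp :: "('e \<Rightarrow> 'e \<Rightarrow> real) \<Rightarrow> ('e \<Rightarrow> real) \<Rightarrow> 'e" where
  "sharp h \<theta> = (THE t. \<forall>w. h t w = \<theta> w)"

definition lee_field :: "('e::euclidean_space) bilin \<Rightarrow> 'e endo \<Rightarrow> 'e \<Rightarrow> 'e" where
  "lee_field g I x = sharp (g x) (lee_form g I x)"

definition orth_compl :: "('e \<Rightarrow> 'e \<Rightarrow> real) \<Rightarrow> 'e set \<Rightarrow> 'e set" where
  "orth_compl h V = {v. \<forall>w\<in>V. h v w = 0}"

definition orth_proj :: "('e::euclidean_space \<Rightarrow> 'e \<Rightarrow> real) \<Rightarrow> 'e set \<Rightarrow> 'e \<Rightarrow> 'e" where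
  "orth_proj h V u = (THE p. p \<in> V \<and> u - p \<in> orth_compl h V)"

text \<open>\<open>I = J\<close> on \<open>D\<close> and \<open>I = -J\<close> on the orthogonal complement of \<open>D\<close>.  The other choice of sign is
  obtained by interchanging \<open>D\<close> with its complement; everything below is unaffected by it.\<close>

definition opposite_structure ::
  "('e::euclidean_space) bilin \<Rightarrow> 'e endo \<Rightarrow> ('e \<Rightarrow> 'e set) \<Rightarrow> 'e endo" where
  "opposite_structure g J D x u =
     J x (orth_proj (g x) (D x) u) - J x (u - orth_proj (g x) (D x) u)"

definition rank2_distribution_on :: "('e::euclidean_space) set \<Rightarrow> ('e \<Rightarrow> 'e set) \<Rightarrow> bool" where
  "rank2_distribution_on S D \<longleftrightarrow>
     (\<forall>x\<in>S. subspace (D x) \<and> dim (D x) = 2) \<and>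
     (\<forall>x\<in>S. \<exists>W X Y. open W \<and> x \<in> W \<and> W \<subseteq> S \<and> smooth_on W X \<and> smooth_on W Y \<and>
        (\<forall>y\<in>W. D y = span {X y, Y y}))"

definition locally_conf_kahler_on :: "('e::euclidean_space) set \<Rightarrow> 'e bilin \<Rightarrow> 'e endo \<Rightarrow> bool" where
  "locally_conf_kahler_on S g I \<longleftrightarrow>
     (\<forall>x\<in>S. \<exists>W f. open W \<and> x \<in> W \<and> W \<subseteq> S \<and> smooth_on W f \<and>
        kahler_on W (\<lambda>y u v. exp (f y) * g y u v) I)"


subsection \<open>Smooth manifolds given by an atlas\<close>

text \<open>A chart \<open>i\<close> is given by its inverse \<open>cpar i\<close>, a parametrisation defined on the open set
  \<open>cdom i\<close>.  A tensor field is a family, indexed by the charts, of fields on the sets \<open>cdom i\<close>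
  that are related by the differentials of the transition maps.\<close>

record ('i, 'e, 'p) atlas =
  pts :: "'p set"
  charts :: "'i set"
  cdom :: "'i \<Rightarrow> 'e set"
  cpar :: "'i \<Rightarrow> 'e \<Rightarrow> 'p"

definition overlap :: "('i, 'e, 'p) atlas \<Rightarrow> 'i \<Rightarrow> 'i \<Rightarrow> 'e set" where
  "overlap A i j = {x \<in> cdom A i. cpar A i x \<in> cpar A j ` cdom A j}"

definition transition :: "('i, 'e, 'p) atlas \<Rightarrow> 'i \<Rightarrow> 'i \<Rightarrow> 'e \<Rightarrow> 'e" where
  "transition A i j x = inv_into (cdom A j) (cpar A j) (cpar A i x)"

definition dtransition ::
  "('i, 'e::real_normed_vector, 'p) atlas \<Rightarrow> 'i \<Rightarrow> 'i \<Rightarrow> 'e \<Rightarrow> 'e \<Rightarrow> 'e" where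
  "dtransition A i j x = frechet_derivative (transition A i j) (at x)"

definition atlas_topology :: "('i, 'e::topological_space, 'p) atlas \<Rightarrow> 'p topology" where
  "atlas_topology A =
     topology (\<lambda>U. U \<subseteq> pts A \<and> (\<forall>i\<in>charts A. open {x \<in> cdom A i. cpar A i x \<in> U}))"

lemma openin_atlas_topology:
  "openin (atlas_topology A) U \<longleftrightarrow>
     U \<subseteq> pts A \<and> (\<forall>i\<in>charts A. open {x \<in> cdom A i. cpar A i x \<in> U})"
proof -
  let ?P = "\<lambda>U. U \<subseteq> pts A \<and> (\<forall>i\<in>charts A. open {x \<in> cdom A i. cpar A i x \<in> U})"
  have "istopology ?P"
    unfolding istopology_def
  proof (intro conjI allI impI)
    fix S T assume ST: "?P S" "?P T"
    show "S \<inter> T \<subseteq> pts A" using ST by blast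
    show "\<forall>i\<in>charts A. open {x \<in> cdom A i. cpar A i x \<in> S \<inter> T}"
    proof
      fix i assume i: "i \<in> charts A"
      have "{x \<in> cdom A i. cpar A i x \<in> S \<inter> T} =
        {x \<in> cdom A i. cpar A i x \<in> S} \<inter> {x \<in> cdom A i. cpar A i x \<in> T}" by blast
      then show "open {x \<in> cdom A i. cpar A i x \<in> S \<inter> T}" using ST i by auto
    qed
  next
    fix K assume K: "\<forall>S\<in>K. ?P S"
    show "\<Union>K \<subseteq> pts A" using K by blast
    show "\<forall>i\<in>charts A. open {x \<in> cdom A i. cpar A i x \<in> \<Union>K}"
    proof
      fix i assume i: "i \<in> charts A"
      have "{x \<in> cdom A i. cpar A i x \<in> \<Union>K} = (\<Union>S\<in>K. {x \<in> cdom A i. cpar A i x \<in> S})" by blast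
      then show "open {x \<in> cdom A i. cpar A i x \<in> \<Union>K}" using K i by auto
    qed
  qed
  then show ?thesis by (simp add: atlas_topology_def)
qed

definition smooth_manifold :: "('i, 'e::euclidean_space, 'p) atlas \<Rightarrow> bool" where
  "smooth_manifold A \<longleftrightarrow>
     pts A = (\<Union>i\<in>charts A. cpar A i ` cdom A i) \<and>
     (\<forall>i\<in>charts A. open (cdom A i) \<and> inj_on (cpar A i) (cdom A i)) \<and>
     (\<forall>i\<in>charts A. \<forall>j\<in>charts A. open (overlap A i j) \<and> smooth_on (overlap A i j) (transition A i j)) \<and>
     Hausdorff_space (atlas_topology A) \<and> second_countable (atlas_topology A)"

definition restrict_atlas :: "('i, 'e, 'p) atlas \<Rightarrow> 'p set \<Rightarrow> ('i, 'e, 'p) atlas" where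
  "restrict_atlas A U =
     A\<lparr>pts := pts A \<inter> U, cdom := (\<lambda>i. {x \<in> cdom A i. cpar A i x \<in> U})\<rparr>"

definition bilin_field :: "('i, 'e::euclidean_space, 'p) atlas \<Rightarrow> ('i \<Rightarrow> 'e bilin) \<Rightarrow> bool" where
  "bilin_field A g \<longleftrightarrow>
     (\<forall>i\<in>charts A. \<forall>j\<in>charts A. \<forall>x\<in>overlap A i j. \<forall>u v.
        g i x u v = g j (transition A i j x) (dtransition A i j x u) (dtransition A i j x v))"

definition endo_field :: "('i, 'e::euclidean_space, 'p) atlas \<Rightarrow> ('i \<Rightarrow> 'e endo) \<Rightarrow> bool" where
  "endo_field A J \<longleftrightarrow>
     (\<forall>i\<in>charts A. \<forall>j\<in>charts A. \<forall>x\<in>overlap A i j. \<forall>u.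
        dtransition A i j x (J i x u) = J j (transition A i j x) (dtransition A i j x u))"

definition riemannian_metric :: "('i, 'e::euclidean_space, 'p) atlas \<Rightarrow> ('i \<Rightarrow> 'e bilin) \<Rightarrow> bool" where
  "riemannian_metric A g \<longleftrightarrow> bilin_field A g \<and> (\<forall>i\<in>charts A. riemannian_on (cdom A i) (g i))"

definition rank2_distribution :: "('i, 'e::euclidean_space, 'p) atlas \<Rightarrow> ('i \<Rightarrow> 'e \<Rightarrow> 'e set) \<Rightarrow> bool" where
  "rank2_distribution A D \<longleftrightarrow>
     (\<forall>i\<in>charts A. rank2_distribution_on (cdom A i) (D i)) \<and>
     (\<forall>i\<in>charts A. \<forall>j\<in>charts A. \<forall>x\<in>overlap A i j.
        D j (transition A i j x) = dtransition A i j x ` D i x)"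


subsection \<open>QCH Kaehler surfaces and Calabi type\<close>

definition kahler_surface ::
  "('i, 'e::euclidean_space, 'p) atlas \<Rightarrow> ('i \<Rightarrow> 'e bilin) \<Rightarrow> ('i \<Rightarrow> 'e endo) \<Rightarrow> bool" where
  "kahler_surface A g J \<longleftrightarrow>
     DIM('e) = 4 \<and> smooth_manifold A \<and> riemannian_metric A g \<and> endo_field A J \<and>
     (\<forall>i\<in>charts A. kahler_on (cdom A i) (g i) (J i))"

definition qch_distribution ::
  "('i, 'e::euclidean_space, 'p) atlas \<Rightarrow> ('i \<Rightarrow> 'e bilin) \<Rightarrow> ('i \<Rightarrow> 'e endo) \<Rightarrow>
   ('i \<Rightarrow> 'e \<Rightarrow> 'e set) \<Rightarrow> bool" where
  "qch_distribution A g J D \<longleftrightarrow>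
     rank2_distribution A D \<and>
     (\<forall>i\<in>charts A. \<forall>x\<in>cdom A i. J i x ` D i x \<subseteq> D i x) \<and>
     (\<forall>i\<in>charts A. \<forall>x\<in>cdom A i. \<exists>\<phi>::real \<Rightarrow> real. \<forall>u. g i x u u = 1 \<longrightarrow>
        hol_curv (g i) (J i) x u =
          \<phi> (sqrt (g i x (orth_proj (g i x) (D i x) u) (orth_proj (g i x) (D i x) u))))"

definition qch_kahler_surface ::
  "('i, 'e::euclidean_space, 'p) atlas \<Rightarrow> ('i \<Rightarrow> 'e bilin) \<Rightarrow> ('i \<Rightarrow> 'e endo) \<Rightarrow> bool" where
  "qch_kahler_surface A g J \<longleftrightarrow> kahler_surface A g J \<and> (\<exists>D. qch_distribution A g J D)"

text \<open>The null distribution of \<open>\<nabla>I\<close> is required both to be spanned by the Lee field and its image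
  under \<open>I\<close>, and to consist of the vectors along which \<open>I\<close> is parallel.\<close>

definition generalized_calabi ::
  "('i, 'e::euclidean_space, 'p) atlas \<Rightarrow> ('i \<Rightarrow> 'e bilin) \<Rightarrow> ('i \<Rightarrow> 'e endo) \<Rightarrow>
   ('i \<Rightarrow> 'e \<Rightarrow> 'e set) \<Rightarrow> bool" where
  "generalized_calabi A g J D \<longleftrightarrow>
     (let I = (\<lambda>i. opposite_structure (g i) (J i) (D i));
          D0 = (\<lambda>i x. span {lee_field (g i) (I i) x, I i x (lee_field (g i) (I i) x)}) in
      (\<forall>i\<in>charts A. hermitian_on (cdom A i) (g i) (I i)) \<and>
      (\<forall>i\<in>charts A. \<forall>x\<in>cdom A i. norm_cov_deriv_endo (g i) (I i) x > 0) \<and>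
      (\<forall>i\<in>charts A. \<forall>x\<in>cdom A i. D0 i x = {u. \<forall>v. cov_deriv_endo (g i) (I i) x u v = 0}) \<and>
      ((\<forall>i\<in>charts A. \<forall>x\<in>cdom A i. D i x = D0 i x) \<or>
       (\<forall>i\<in>charts A. \<forall>x\<in>cdom A i. orth_compl (g i x) (D i x) = D0 i x)))"

definition calabi_type_kahler_surface ::
  "('i, 'e::euclidean_space, 'p) atlas \<Rightarrow> ('i \<Rightarrow> 'e bilin) \<Rightarrow> ('i \<Rightarrow> 'e endo) \<Rightarrow> bool" where
  "calabi_type_kahler_surface A g J \<longleftrightarrow>
     kahler_surface A g J \<and>
     (\<exists>D. qch_distribution A g J D \<and> generalized_calabi A g J D \<and>
        (\<forall>i\<in>charts A. locally_conf_kahler_on (cdom A i) (g i)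
           (opposite_structure (g i) (J i) (D i))))"

definition qch_kahler_surface_of_calabi_type ::
  "('i, 'e::euclidean_space, 'p) atlas \<Rightarrow> ('i \<Rightarrow> 'e bilin) \<Rightarrow> ('i \<Rightarrow> 'e endo) \<Rightarrow> bool" where
  "qch_kahler_surface_of_calabi_type A g J \<longleftrightarrow>
     qch_kahler_surface A g J \<and>
     (\<exists>U. openin (atlas_topology A) U \<and> (atlas_topology A) closure_of U = pts A \<and>
        calabi_type_kahler_surface (restrict_atlas A U) g J)"


subsection \<open>The blow-up of the complex plane at the origin\<close>

type_synonym C2 = "complex \<times> complex"

definition cscale :: "complex \<Rightarrow> C2 \<Rightarrow> C2" where
  "cscale c v = (c * fst v, c * snd v)"

definition cline :: "C2 \<Rightarrow> C2 set" where
  "cline v = range (\<lambda>c. cscale c v)"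

text \<open>A point of the projective line is a complex line through the origin.\<close>

definition CP1 :: "C2 set set" where
  "CP1 = {cline v | v. v \<noteq> 0}"

text \<open>Both affine charts of the blow-up are defined on all of \<open>\<complex>\<^sup>2\<close>: the lines are \<open>[1 : b]\<close> and
  \<open>[b : 1]\<close> respectively, and \<open>a\<close> is the coordinate along the line.\<close>

definition blowup :: "(bool, C2, C2 \<times> C2 set) atlas" where
  "blowup = \<lparr>
     pts = {(z, L). L \<in> CP1 \<and> z \<in> L},
     charts = UNIV,
     cdom = (\<lambda>_. UNIV),
     cpar = (\<lambda>i (a, b). if i then ((a, a * b), cline (1, b)) else ((a * b, a), cline (b, 1)))\<rparr>"

text \<open>The charts of the blow-up are holomorphic, so its complex structure is multiplication by
  \<open>\<i>\<close> in each of them.\<close>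

definition J_std :: "C2 endo" where
  "J_std x v = cscale \<i> v"

definition blowup_J :: "bool \<Rightarrow> C2 endo" where
  "blowup_J i = J_std"


subsection \<open>The Burns metric\<close>

text \<open>The components are numbered 1 and 2.\<close>

definition ccoord :: "nat \<Rightarrow> C2 \<Rightarrow> complex" where
  "ccoord j v = (if j = 1 then fst v else snd v)"

definition cbasis :: "nat \<Rightarrow> C2" where
  "cbasis j = (if j = 1 then (1, 0) else (0, 1))"

definition wirtinger :: "nat \<Rightarrow> (C2 \<Rightarrow> complex) \<Rightarrow> C2 \<Rightarrow> complex" where
  "wirtinger j f z =
     (pderivative f z (cbasis j) - \<i> * pderivative f z (cscale \<i> (cbasis j))) / 2"

definition wirtinger_bar :: "nat \<Rightarrow> (C2 \<Rightarrow> complex) \<Rightarrow> C2 \<Rightarrow> complex" where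
  "wirtinger_bar j f z =
     (pderivative f z (cbasis j) + \<i> * pderivative f z (cscale \<i> (cbasis j))) / 2"

text \<open>The 2-form \<open>\<i> \<Sum>\<^sub>j\<^sub>k f\<^sub>j\<^sub>k dz\<^sub>j \<and> d(cnj z\<^sub>k)\<close>, where \<open>f\<^sub>j\<^sub>k\<close> is the derivative of \<open>f\<close> by \<open>z\<^sub>j\<close> and
  \<open>cnj z\<^sub>k\<close>, evaluated on a pair of real tangent vectors; the wedge product is normalised as above.\<close>

definition i_ddbar :: "(C2 \<Rightarrow> complex) \<Rightarrow> C2 \<Rightarrow> C2 \<Rightarrow> C2 \<Rightarrow> complex" where
  "i_ddbar f z X Y = \<i> * (\<Sum>j\<in>{1,2}. \<Sum>k\<in>{1,2}. wirtinger j (wirtinger_bar k f) z *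
     (ccoord j X * cnj (ccoord k Y) - ccoord j Y * cnj (ccoord k X)))"

definition burns_potential :: "real \<Rightarrow> C2 \<Rightarrow> complex" where
  "burns_potential m z = complex_of_real ((norm z)\<^sup>2 + m * ln ((norm z)\<^sup>2))"

definition blow_down :: "bool \<Rightarrow> C2 \<Rightarrow> C2" where
  "blow_down i x = fst (cpar blowup i x)"

text \<open>\<open>g\<close> is a smooth metric on the blow-up which, off the exceptional divisor, is the pull-back
  under the blow-down map of the metric with Kaehler form \<open>\<omega>(X,Y) = g(JX,Y)\<close> given by the
  potential.\<close>

definition burns_metric :: "real \<Rightarrow> (bool \<Rightarrow> C2 bilin) \<Rightarrow> bool" where
  "burns_metric m g \<longleftrightarrow>
     riemannian_metric blowup g \<and>
     (\<forall>i x. blow_down i x \<noteq> 0 \<longrightarrow>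
        (\<forall>X Y. complex_of_real (g i x (blowup_J i x X) Y) =
           i_ddbar (burns_potential m) (blow_down i x)
             (pderivative (blow_down i) x X) (pderivative (blow_down i) x Y)))"

end

theory Submission
  imports Defs
begin

text \<open>In the chart \<open>(a, b)\<close> the blow-down is \<open>(a, a b)\<close> or \<open>(a b, a)\<close>, so \<open>\<parallel>z\<parallel>\<^sup>2 = s |a|\<^sup>2\<close> with
  \<open>s = 1 + |b|\<^sup>2\<close>, and since \<open>ln |a|\<^sup>2\<close> is pluriharmonic the potential may be replaced by
  \<open>s |a|\<^sup>2 + m ln s\<close>, which is smooth across the exceptional divisor \<open>a = 0\<close>.  Its complex Hessian is a
  Hermitian form with the same expression in both charts (\<open>burns_herm\<close>); twice its real part is the
  extended metric.  It is unique because the complement of the divisor is dense.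

  Everything else is read off from one diagonalisation.  The lines of the blow-up make it a
  bundle over the projective line; let \<open>\<D>\<close> be the tangent spaces of the fibres
  (\<open>vertical\<close>), and write a tangent vector \<open>u\<close> by its vertical part \<open>p = u\<^sub>1 + (a b' / s) u\<^sub>2\<close> and its
  component \<open>q = u\<^sub>2\<close>, where \<open>b'\<close> is the conjugate of \<open>b\<close>.  With \<open>P = \<parallel>z\<parallel>\<^sup>2 + m\<close> the Hermitian form is
  \<open>s |p|\<^sup>2 + (P / s\<^sup>2) |q|\<^sup>2\<close> (\<open>burns_herm_adapted\<close>).  The metric is invariant under the unitary group,
  and indeed the curvature is a quartic form in \<open>|p|\<close> and \<open>|q|\<close> only; on unit vectors it is a function
  of \<open>P\<close> and \<open>|u\<^sub>\<D>|\<^sup>2\<close> (\<open>hol_curv_burns\<close>).  This is the QCH property.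

  The opposite structure \<open>I\<close> multiplies \<open>p\<close> by \<open>\<i>\<close> and \<open>q\<close> by \<open>-\<i>\<close>; the forms \<open>da + (a b' / s) db\<close>
  and \<open>db'\<close>, which are of type \<open>(1, 0)\<close> for it, generate a differential ideal, hence it is integrable
  (\<open>nijenhuis_opposite\<close>).
  As the Kaehler form \<open>\<omega>\<close> is closed, \<open>d\<omega>\<^sub>I\<close> equals minus twice the differential of the horizontal part
  of \<open>\<omega>\<close>, which gives the Lee form \<open>\<theta> = d ln P\<close> (\<open>ext_deriv_kform_opposite\<close>).  It is exact, so
  \<open>P\<^sup>-\<^sup>2 g\<close> is Kaehler for \<open>I\<close>, and its dual field \<open>(a / P, 0)\<close> spans \<open>\<D>\<close> over the complex
  numbers wherever \<open>a \<noteq> 0\<close>.  Finally the two components of \<open>\<nabla>\<^sub>u I\<close> are multiples of \<open>q\<close> and of its conjugate,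
  with coefficients that vanish only on the divisor (\<open>cov_deriv_opposite\<close>); so off the divisor \<open>\<nabla>I \<noteq> 0\<close> and \<open>I\<close> is parallel
  exactly along \<open>\<D>\<close>.  The complement of the divisor is therefore the required open dense set.\<close>

section \<open>Smooth functions on open sets\<close>

lemma pderivativeI: "(f has_derivative f') (at x) \<Longrightarrow> pderivative f x u = f' u"
  unfolding pderivative_def by (metis frechet_derivative_at)

lemma frechet_derivative_cong_open:
  assumes "open S" "x \<in> S" "\<And>y. y \<in> S \<Longrightarrow> f y = g y"
  shows "frechet_derivative f (at x) = frechet_derivative g (at x)"
proof -
  have "(f has_derivative D) (at x) \<longleftrightarrow> (g has_derivative D) (at x)" for D
    using assms has_derivative_transform_within_open by metis
  then show ?thesis unfolding frechet_derivative_def by simp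
qed

lemma pderivative_cong_open:
  assumes "open S" "x \<in> S" "\<And>y. y \<in> S \<Longrightarrow> f y = g y"
  shows "pderivative f x u = pderivative g x u"
  unfolding pderivative_def using frechet_derivative_cong_open[OF assms] by simp

lemma differentiable_cong_open:
  assumes "open S" "x \<in> S" "\<And>y. y \<in> S \<Longrightarrow> f y = g y"
  shows "f differentiable (at x) \<longleftrightarrow> g differentiable (at x)"
  unfolding differentiable_def using assms has_derivative_transform_within_open by metis

text \<open>\<open>Ck_on\<close> is phrased with the total function \<open>frechet_derivative\<close>, so smoothness of a function given by a
  formula on an open set reduces to the iterated derivatives depending only on the germ.\<close>

lemma Ck_on_cong_open:
  assumes "open S" "\<And>y. y \<in> S \<Longrightarrow> f y = g y"
  shows "Ck_on k f S \<longleftrightarrow> Ck_on k g S"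
  using assms(2)
proof (induction k arbitrary: f g)
  case 0
  then show ?case by (simp cong: continuous_on_cong)
next
  case (Suc k)
  have "Ck_on k (\<lambda>x. frechet_derivative f (at x) v) S \<longleftrightarrow>
        Ck_on k (\<lambda>x. frechet_derivative g (at x) v) S" for v
    by (rule Suc.IH) (simp add: frechet_derivative_cong_open[OF assms(1) _ Suc.prems])
  then show ?case
    using differentiable_cong_open[OF assms(1) _ Suc.prems] by simp
qed

lemma Ck_on_subset: "Ck_on k f S \<Longrightarrow> T \<subseteq> S \<Longrightarrow> Ck_on k f T"
proof (induction k arbitrary: f)
  case 0
  then show ?case by (auto intro: continuous_on_subset)
next
  case (Suc k)
  then show ?case by auto
qed

text \<open>The working form of the recursion: any explicit derivative may replace \<open>frechet_derivative\<close>.\<close>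

lemma Ck_on_SucI:
  assumes "open S"
    and "\<And>x. x \<in> S \<Longrightarrow> (f has_derivative f' x) (at x)"
    and "\<And>v. Ck_on k (\<lambda>x. f' x v) S"
  shows "Ck_on (Suc k) f S"
proof -
  have "Ck_on k (\<lambda>x. frechet_derivative f (at x) v) S" for v
    using assms(3)[of v] Ck_on_cong_open[OF assms(1)] frechet_derivative_at[OF assms(2)]
    by (smt (verit, ccfv_threshold))
  then show ?thesis using assms(2) by (auto simp: differentiable_def)
qed

lemma Ck_on_SucD: "Ck_on (Suc k) f S \<Longrightarrow> Ck_on k f S"
proof (induction k arbitrary: f)
  case 0
  then show ?case
    by (auto intro!: continuous_at_imp_continuous_on differentiable_imp_continuous_within)
next
  case (Suc k)
  then show ?case by (metis Ck_on.simps(2))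
qed

lemma Ck_on_const: "Ck_on k (\<lambda>x. c) S"
  by (induction k arbitrary: c) auto

lemma Ck_on_bounded_linear:
  assumes "bounded_linear L" "open S" "Ck_on k f S"
  shows "Ck_on k (\<lambda>x. L (f x)) S"
  using assms(3)
proof (induction k arbitrary: f)
  case 0
  then show ?case using bounded_linear.continuous_on[OF assms(1)] by auto
next
  case (Suc k)
  show ?case
  proof (rule Ck_on_SucI[OF assms(2)])
    fix x assume "x \<in> S"
    then have "(f has_derivative frechet_derivative f (at x)) (at x)"
      using Suc.prems by (simp add: frechet_derivative_works)
    then show "((\<lambda>x. L (f x)) has_derivative (\<lambda>v. L (frechet_derivative f (at x) v))) (at x)"
      by (rule bounded_linear.has_derivative[OF assms(1)])
  qed (use Suc in auto)
qed

lemma Ck_on_add: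
  assumes "open S" "Ck_on k f S" "Ck_on k g S"
  shows "Ck_on k (\<lambda>x. f x + g x) S"
  using assms(2,3)
proof (induction k arbitrary: f g)
  case 0
  then show ?case by (auto intro: continuous_on_add)
next
  case (Suc k)
  show ?case
  proof (rule Ck_on_SucI[OF assms(1)])
    fix x assume "x \<in> S"
    then show "((\<lambda>x. f x + g x) has_derivative
        (\<lambda>v. frechet_derivative f (at x) v + frechet_derivative g (at x) v)) (at x)"
      using Suc.prems by (intro has_derivative_add) (auto simp: frechet_derivative_works)
  qed (use Suc in auto)
qed

text \<open>The product rule expresses the derivatives of \<open>f g\<close> by products of functions that are \<open>k\<close> times
  differentiable, so the induction closes on the statement for all pairs at once.\<close>

lemma Ck_on_mult:
  fixes f g :: "'a::real_normed_vector \<Rightarrow> 'b::real_normed_algebra"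
  assumes "open S" "Ck_on k f S" "Ck_on k g S"
  shows "Ck_on k (\<lambda>x. f x * g x) S"
  using assms(2,3)
proof (induction k arbitrary: f g)
  case 0
  then show ?case by (auto intro: continuous_on_mult)
next
  case (Suc k)
  show ?case
  proof (rule Ck_on_SucI[OF assms(1)])
    fix x assume "x \<in> S"
    then show "((\<lambda>x. f x * g x) has_derivative
        (\<lambda>v. f x * frechet_derivative g (at x) v + frechet_derivative f (at x) v * g x)) (at x)"
      using Suc.prems by (intro has_derivative_mult) (auto simp: frechet_derivative_works)
  next
    fix v
    show "Ck_on k (\<lambda>x. f x * frechet_derivative g (at x) v + frechet_derivative f (at x) v * g x) S"
      using Suc.prems Ck_on_SucD[OF Suc.prems(1)] Ck_on_SucD[OF Suc.prems(2)]
      by (intro Ck_on_add[OF assms(1)] Suc.IH) auto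
  qed
qed

lemma Ck_on_inverse:
  fixes f :: "'a::real_normed_vector \<Rightarrow> 'b::real_normed_field"
  assumes "open S" "Ck_on k f S" "\<And>x. x \<in> S \<Longrightarrow> f x \<noteq> 0"
  shows "Ck_on k (\<lambda>x. inverse (f x)) S"
  using assms(2)
proof (induction k)
  case 0
  then show ?case using assms(3) by (auto intro: continuous_on_inverse)
next
  case (Suc k)
  show ?case
  proof (rule Ck_on_SucI[OF assms(1)])
    fix x assume "x \<in> S"
    then show "((\<lambda>x. inverse (f x)) has_derivative
        (\<lambda>v. - 1 * (inverse (f x) * frechet_derivative f (at x) v * inverse (f x)))) (at x)"
      using Suc.prems assms(3)
      by (auto intro!: derivative_eq_intros simp: frechet_derivative_works[symmetric] simp flip: frechet_derivative_works)
  next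
    fix v
    show "Ck_on k (\<lambda>x. - 1 * (inverse (f x) * frechet_derivative f (at x) v * inverse (f x))) S"
      using Suc.prems Suc.IH Ck_on_SucD[OF Suc.prems]
      by (intro Ck_on_mult[OF assms(1)] Ck_on_const) auto
  qed
qed

lemma Ck_on_ln:
  fixes f :: "'a::real_normed_vector \<Rightarrow> real"
  assumes "open S" "Ck_on k f S" "\<And>x. x \<in> S \<Longrightarrow> f x > 0"
  shows "Ck_on k (\<lambda>x. ln (f x)) S"
proof (cases k)
  case 0
  then show ?thesis using assms by (force intro: continuous_on_ln)
next
  case (Suc l)
  have nz: "f x \<noteq> 0" if "x \<in> S" for x using assms(3)[OF that] by simp
  show ?thesis unfolding Suc
  proof (rule Ck_on_SucI[OF assms(1)])
    fix x assume "x \<in> S"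
    then show "((\<lambda>x. ln (f x)) has_derivative
        (\<lambda>v. frechet_derivative f (at x) v * inverse (f x))) (at x)"
      using assms Suc by (intro has_derivative_ln) (auto simp: frechet_derivative_works)
  next
    fix v
    show "Ck_on l (\<lambda>x. frechet_derivative f (at x) v * inverse (f x)) S"
      using assms Suc Ck_on_SucD[of l f S] nz
      by (intro Ck_on_mult[OF assms(1)] Ck_on_inverse[OF assms(1)]) auto
  qed
qed

named_theorems smooth_intros

lemma smooth_on_subset: "smooth_on S f \<Longrightarrow> T \<subseteq> S \<Longrightarrow> smooth_on T f"
  by (auto simp: smooth_on_def intro: Ck_on_subset)

lemma smooth_on_cong_open:
  assumes "open S" "\<And>y. y \<in> S \<Longrightarrow> f y = g y"
  shows "smooth_on S f \<longleftrightarrow> smooth_on S g"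
  using Ck_on_cong_open[OF assms] by (simp add: smooth_on_def)

lemma smooth_on_imp_continuous_on: "smooth_on S f \<Longrightarrow> continuous_on S f"
  unfolding smooth_on_def by (metis Ck_on.simps(1))

lemma smooth_on_const [smooth_intros]: "smooth_on S (\<lambda>x. c)"
  by (simp add: smooth_on_def Ck_on_const)

lemma smooth_on_bounded_linear:
  assumes "bounded_linear L" "open S" "smooth_on S f"
  shows "smooth_on S (\<lambda>x. L (f x))"
  using assms by (simp add: smooth_on_def Ck_on_bounded_linear)

lemma smooth_on_id: "open S \<Longrightarrow> smooth_on S (\<lambda>x. x)"
proof -
  assume S: "open S"
  have "Ck_on k (\<lambda>x. x) S" for k
    by (cases k) (auto intro!: Ck_on_SucI[OF S has_derivative_ident] Ck_on_const)
  then show ?thesis by (simp add: smooth_on_def)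
qed

lemma smooth_on_linear: "bounded_linear L \<Longrightarrow> open S \<Longrightarrow> smooth_on S L"
  using smooth_on_bounded_linear[OF _ _ smooth_on_id] by blast

lemma smooth_on_fst_snd [smooth_intros]:
  assumes "open S"
  shows "smooth_on S fst" "smooth_on S snd"
  using assms by (auto intro: smooth_on_linear bounded_linear_fst bounded_linear_snd)

lemma smooth_on_real_linear [smooth_intros]:
  assumes "open S" "smooth_on S f"
  shows "smooth_on S (\<lambda>x. cnj (f x))" "smooth_on S (\<lambda>x. Re (f x))"
  using assms by (auto intro: smooth_on_bounded_linear bounded_linear_cnj bounded_linear_Re)

lemma smooth_on_add [smooth_intros]:
  assumes "open S" "smooth_on S f" "smooth_on S g"
  shows "smooth_on S (\<lambda>x. f x + g x)"
  using assms by (simp add: smooth_on_def Ck_on_add)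

lemma smooth_on_mult [smooth_intros]:
  fixes f g :: "'a::real_normed_vector \<Rightarrow> 'b::real_normed_algebra"
  assumes "open S" "smooth_on S f" "smooth_on S g"
  shows "smooth_on S (\<lambda>x. f x * g x)"
  using assms by (simp add: smooth_on_def Ck_on_mult)

lemma smooth_on_minus [smooth_intros]:
  assumes "open S" "smooth_on S f"
  shows "smooth_on S (\<lambda>x. - f x)"
  using smooth_on_bounded_linear[OF bounded_linear_minus[OF bounded_linear_ident] assms] by simp

lemma smooth_on_diff [smooth_intros]:
  assumes "open S" "smooth_on S f" "smooth_on S g"
  shows "smooth_on S (\<lambda>x. f x - g x)"
  using smooth_on_add[OF assms(1,2) smooth_on_minus[OF assms(1,3)]] by simp

lemma smooth_on_inverse [smooth_intros]:
  fixes f :: "'a::real_normed_vector \<Rightarrow> 'b::real_normed_field"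
  assumes "open S" "smooth_on S f" "\<And>x. x \<in> S \<Longrightarrow> f x \<noteq> 0"
  shows "smooth_on S (\<lambda>x. inverse (f x))"
  using assms by (simp add: smooth_on_def Ck_on_inverse)

lemma smooth_on_divide [smooth_intros]:
  fixes f g :: "'a::real_normed_vector \<Rightarrow> 'b::real_normed_field"
  assumes "open S" "smooth_on S f" "smooth_on S g" "\<And>x. x \<in> S \<Longrightarrow> g x \<noteq> 0"
  shows "smooth_on S (\<lambda>x. f x / g x)"
  unfolding divide_inverse using assms by (intro smooth_intros)

lemma smooth_on_power [smooth_intros]:
  fixes f :: "'a::real_normed_vector \<Rightarrow> 'b::real_normed_field"
  assumes "open S" "smooth_on S f"
  shows "smooth_on S (\<lambda>x. f x ^ n)"
  by (induction n) (auto intro!: smooth_intros assms)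

lemma smooth_on_ln [smooth_intros]:
  fixes f :: "'a::real_normed_vector \<Rightarrow> real"
  assumes "open S" "smooth_on S f" "\<And>x. x \<in> S \<Longrightarrow> f x > 0"
  shows "smooth_on S (\<lambda>x. ln (f x))"
  using assms by (simp add: smooth_on_def Ck_on_ln)

lemma smooth_on_Pair [smooth_intros]:
  assumes "open S" "smooth_on S f" "smooth_on S g"
  shows "smooth_on S (\<lambda>x. (f x, g x))"
proof -
  have 1: "bounded_linear (\<lambda>a::'b. (a, 0::'c))" "bounded_linear (\<lambda>b::'c. (0::'b, b))"
    by (auto intro!: bounded_linear_Pair bounded_linear_ident bounded_linear_zero)
  have "smooth_on S (\<lambda>x. (f x, 0) + (0, g x))"
    by (intro smooth_on_add smooth_on_bounded_linear[OF 1(1)] smooth_on_bounded_linear[OF 1(2)] assms)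
  then show ?thesis by simp
qed

section \<open>Open submanifolds\<close>

lemma transition_self:
  assumes "inj_on (cpar A i) (cdom A i)" "x \<in> cdom A i"
  shows "transition A i i x = x"
  using assms by (simp add: transition_def)

lemma transition_in_cdom:
  assumes "x \<in> overlap A i j"
  shows "transition A i j x \<in> cdom A j" "cpar A j (transition A i j x) = cpar A i x"
  using assms by (auto simp: transition_def overlap_def inv_into_into f_inv_into_f)

lemma transition_eqI:
  assumes "inj_on (cpar A j) (cdom A j)" "y \<in> cdom A j" "cpar A j y = cpar A i x"
  shows "transition A i j x = y"
  using assms unfolding transition_def by (metis inv_into_f_f)

lemma dtransition_self:
  fixes A :: "('i, 'e::euclidean_space, 'p) atlas"
  assumes "open (cdom A i)" "inj_on (cpar A i) (cdom A i)" "x \<in> cdom A i"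
  shows "dtransition A i i x u = u"
proof -
  have "frechet_derivative (transition A i i) (at x) = frechet_derivative (\<lambda>x. x) (at x)"
    by (rule frechet_derivative_cong_open[OF assms(1,3)]) (simp add: transition_self assms(2))
  then show ?thesis by (simp add: dtransition_def frechet_derivative_ident)
qed

lemma restrict_atlas_simps:
  "pts (restrict_atlas A U) = pts A \<inter> U" "charts (restrict_atlas A U) = charts A"
  "cpar (restrict_atlas A U) = cpar A"
  "cdom (restrict_atlas A U) i = {x \<in> cdom A i. cpar A i x \<in> U}"
  by (simp_all add: restrict_atlas_def)

lemma overlap_restrict:
  "overlap (restrict_atlas A U) i j = {x \<in> overlap A i j. cpar A i x \<in> U}"
  by (auto simp: overlap_def restrict_atlas_simps)

text \<open>Restricting the charts changes the inverses behind \<open>transition\<close>, but injectivity of the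
  parametrisations makes both choices agree where the smaller one is meaningful.\<close>

lemma transition_restrict:
  assumes "smooth_manifold A" "i \<in> charts A" "j \<in> charts A"
    and x: "x \<in> overlap (restrict_atlas A U) i j"
  shows "transition (restrict_atlas A U) i j x = transition A i j x"
proof (rule transition_eqI)
  have "inj_on (cpar A j) (cdom A j)" using assms by (simp add: smooth_manifold_def)
  then show "inj_on (cpar (restrict_atlas A U) j) (cdom (restrict_atlas A U) j)"
    by (auto simp: restrict_atlas_simps inj_on_def)
  show "transition A i j x \<in> cdom (restrict_atlas A U) j"
    "cpar (restrict_atlas A U) j (transition A i j x) = cpar (restrict_atlas A U) i x"
    using x transition_in_cdom[of x A i j] by (auto simp: restrict_atlas_simps overlap_restrict)
qed

lemma openin_chart_preimage:
  assumes "openin (atlas_topology A) U" "i \<in> charts A"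
  shows "open {x \<in> cdom A i. cpar A i x \<in> U}"
  using assms by (simp add: openin_atlas_topology)

lemma open_overlap_restrict:
  assumes "smooth_manifold A" "openin (atlas_topology A) U" "i \<in> charts A" "j \<in> charts A"
  shows "open (overlap (restrict_atlas A U) i j)"
proof -
  have "overlap (restrict_atlas A U) i j = overlap A i j \<inter> {x \<in> cdom A i. cpar A i x \<in> U}"
    by (auto simp: overlap_restrict) (auto simp: overlap_def)
  then show ?thesis
    using assms openin_chart_preimage[OF assms(2,3)] by (auto simp: smooth_manifold_def)
qed

lemma dtransition_restrict:
  assumes "smooth_manifold A" "openin (atlas_topology A) U" "i \<in> charts A" "j \<in> charts A"
    and x: "x \<in> overlap (restrict_atlas A U) i j"
  shows "dtransition (restrict_atlas A U) i j x = dtransition A i j x"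
  unfolding dtransition_def
  by (rule frechet_derivative_cong_open[OF open_overlap_restrict[OF assms(1-4)] x])
     (rule transition_restrict[OF assms(1,3,4)])

text \<open>Passing to an open subset commutes with forming the topology; the Hausdorff and
  countability axioms of the submanifold follow from this.\<close>

lemma atlas_topology_restrict:
  assumes "openin (atlas_topology A) U"
  shows "atlas_topology (restrict_atlas A U) = subtopology (atlas_topology A) U"
proof (rule topology_eq[THEN iffD2], intro allI)
  fix V
  have "openin (subtopology (atlas_topology A) U) V \<longleftrightarrow> openin (atlas_topology A) V \<and> V \<subseteq> U"
    using openin_open_subtopology[OF assms] by blast
  also have "\<dots> \<longleftrightarrow> openin (atlas_topology (restrict_atlas A U)) V"
  proof -
    have "{x \<in> cdom A i. cpar A i x \<in> U \<and> cpar A i x \<in> V} = {x \<in> cdom A i. cpar A i x \<in> V}"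
      if "V \<subseteq> U" for i using that by auto
    then show ?thesis by (auto simp: openin_atlas_topology restrict_atlas_simps)
  qed
  finally show "openin (atlas_topology (restrict_atlas A U)) V \<longleftrightarrow>
    openin (subtopology (atlas_topology A) U) V" by simp
qed

lemma smooth_manifold_restrict:
  assumes A: "smooth_manifold A" and U: "openin (atlas_topology A) U"
  shows "smooth_manifold (restrict_atlas A U)"
  unfolding smooth_manifold_def
proof (intro conjI ballI)
  show "pts (restrict_atlas A U) =
    (\<Union>i\<in>charts (restrict_atlas A U). cpar (restrict_atlas A U) i ` cdom (restrict_atlas A U) i)"
    using A by (auto simp: restrict_atlas_simps smooth_manifold_def)
next
  fix i assume "i \<in> charts (restrict_atlas A U)"
  then have i: "i \<in> charts A" by (simp add: restrict_atlas_simps)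
  show "open (cdom (restrict_atlas A U) i)"
    using openin_chart_preimage[OF U i] by (simp add: restrict_atlas_simps)
  show "inj_on (cpar (restrict_atlas A U) i) (cdom (restrict_atlas A U) i)"
    using A i by (auto simp: restrict_atlas_simps smooth_manifold_def inj_on_def)
  fix j assume "j \<in> charts (restrict_atlas A U)"
  then have j: "j \<in> charts A" by (simp add: restrict_atlas_simps)
  let ?O = "overlap (restrict_atlas A U) i j"
  show "open ?O" by (rule open_overlap_restrict[OF A U i j])
  have "smooth_on (overlap A i j) (transition A i j)"
    using A i j by (simp add: smooth_manifold_def)
  then have "smooth_on ?O (transition A i j)"
    by (rule smooth_on_subset) (auto simp: overlap_restrict)
  then show "smooth_on ?O (transition (restrict_atlas A U) i j)"
    using smooth_on_cong_open[OF \<open>open ?O\<close>, of "transition (restrict_atlas A U) i j"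
        "transition A i j"] transition_restrict[OF A i j] by blast
next
  show "Hausdorff_space (atlas_topology (restrict_atlas A U))"
    "second_countable (atlas_topology (restrict_atlas A U))"
    using A unfolding atlas_topology_restrict[OF U]
    by (auto simp: smooth_manifold_def Hausdorff_space_subtopology second_countable_subtopology)
qed

lemma riemannian_on_subset: "riemannian_on S g \<Longrightarrow> T \<subseteq> S \<Longrightarrow> riemannian_on T g"
  by (auto simp: riemannian_on_def intro: smooth_on_subset)

lemma almost_complex_on_subset: "almost_complex_on S J \<Longrightarrow> T \<subseteq> S \<Longrightarrow> almost_complex_on T J"
  by (auto simp: almost_complex_on_def intro: smooth_on_subset)

lemma hermitian_on_subset: "hermitian_on S g J \<Longrightarrow> T \<subseteq> S \<Longrightarrow> hermitian_on T g J"
  unfolding hermitian_on_def using riemannian_on_subset almost_complex_on_subset by blast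

lemma kahler_on_subset: "kahler_on S g J \<Longrightarrow> T \<subseteq> S \<Longrightarrow> kahler_on T g J"
  unfolding kahler_on_def using hermitian_on_subset by blast

lemma rank2_distribution_on_subset:
  assumes "rank2_distribution_on S D" "T \<subseteq> S" "open T"
  shows "rank2_distribution_on T D"
  unfolding rank2_distribution_on_def
proof (intro conjI ballI)
  fix x assume x: "x \<in> T"
  then show "subspace (D x)" "dim (D x) = 2"
    using assms by (auto simp: rank2_distribution_on_def)
  obtain W X Y where W: "open W" "x \<in> W" "smooth_on W X" "smooth_on W Y" "\<forall>y\<in>W. D y = span {X y, Y y}"
    using assms x unfolding rank2_distribution_on_def by blast
  show "\<exists>W X Y. open W \<and> x \<in> W \<and> W \<subseteq> T \<and> smooth_on W X \<and> smooth_on W Y \<and> (\<forall>y\<in>W. D y = span {X y, Y y})"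
    by (rule exI[of _ "W \<inter> T"], rule exI[of _ X], rule exI[of _ Y])
       (use W x assms(3) in \<open>auto intro: smooth_on_subset[of W]\<close>)
qed

lemma kahler_surface_restrict:
  assumes K: "kahler_surface A g J" and U: "openin (atlas_topology A) U"
  shows "kahler_surface (restrict_atlas A U) g J"
proof -
  have A: "smooth_manifold A" using K by (simp add: kahler_surface_def)
  have sub: "cdom (restrict_atlas A U) i \<subseteq> cdom A i" for i by (auto simp: restrict_atlas_simps)
  have ov: "x \<in> overlap (restrict_atlas A U) i j \<Longrightarrow> x \<in> overlap A i j" for x i j
    by (simp add: overlap_restrict)
  show ?thesis
    using K smooth_manifold_restrict[OF A U] ov
    by (auto simp: kahler_surface_def riemannian_metric_def bilin_field_def endo_field_def
        restrict_atlas_simps(2) transition_restrict[OF A] dtransition_restrict[OF A U]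
        intro: riemannian_on_subset[OF _ sub] kahler_on_subset[OF _ sub])
qed

lemma qch_distribution_restrict:
  assumes A: "smooth_manifold A" and Q: "qch_distribution A g J D" and U: "openin (atlas_topology A) U"
  shows "qch_distribution (restrict_atlas A U) g J D"
proof -
  have sub: "cdom (restrict_atlas A U) i \<subseteq> cdom A i" for i by (auto simp: restrict_atlas_simps)
  have ov: "x \<in> overlap (restrict_atlas A U) i j \<Longrightarrow> x \<in> overlap A i j" for x i j
    by (simp add: overlap_restrict)
  have op: "open (cdom (restrict_atlas A U) i)" if "i \<in> charts A" for i
    using smooth_manifold_restrict[OF A U] that by (simp add: smooth_manifold_def restrict_atlas_simps)
  have "rank2_distribution (restrict_atlas A U) D"
    using Q ov
    by (auto simp: qch_distribution_def rank2_distribution_def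
        restrict_atlas_simps(2) transition_restrict[OF A] dtransition_restrict[OF A U]
        intro: rank2_distribution_on_subset[OF _ sub op])
  then show ?thesis
    using Q sub unfolding qch_distribution_def restrict_atlas_simps(2) by (meson subsetD)
qed

section \<open>The topology of an atlas\<close>

text \<open>The topology is defined by preimages under the parametrisations; that the parametrisations are
  themselves open maps comes from continuity of the transition maps.\<close>

lemma openin_chart_image:
  assumes A: "pts A = (\<Union>i\<in>charts A. cpar A i ` cdom A i)"
    "\<And>i j. i \<in> charts A \<Longrightarrow> j \<in> charts A \<Longrightarrow>
       open (overlap A i j) \<and> continuous_on (overlap A i j) (transition A i j)"
    "\<And>i. i \<in> charts A \<Longrightarrow> inj_on (cpar A i) (cdom A i)"
    and i: "i \<in> charts A" and B: "open B" "B \<subseteq> cdom A i"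
  shows "openin (atlas_topology A) (cpar A i ` B)"
  unfolding openin_atlas_topology
proof (intro conjI ballI)
  show "cpar A i ` B \<subseteq> pts A" using A(1) i B by blast
  fix j assume j: "j \<in> charts A"
  have "{x \<in> cdom A j. cpar A j x \<in> cpar A i ` B} = overlap A j i \<inter> transition A j i -` B"
  proof (intro equalityI subsetI)
    fix x assume "x \<in> {x \<in> cdom A j. cpar A j x \<in> cpar A i ` B}"
    then obtain y where y: "x \<in> cdom A j" "y \<in> B" "cpar A j x = cpar A i y" by auto
    then have "transition A j i x = y" using A(3)[OF i] B by (intro transition_eqI) auto
    then show "x \<in> overlap A j i \<inter> transition A j i -` B" using y B by (auto simp: overlap_def)
  next
    fix x assume "x \<in> overlap A j i \<inter> transition A j i -` B"
    then show "x \<in> {x \<in> cdom A j. cpar A j x \<in> cpar A i ` B}"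
      using transition_in_cdom(2)[of x A j i] by (metis (no_types, lifting) IntD1 IntD2 image_eqI
          mem_Collect_eq overlap_def vimageD)
  qed
  then show "open {x \<in> cdom A j. cpar A j x \<in> cpar A i ` B}"
    using A(2)[OF j i] B(1) continuous_open_preimage by metis
qed

lemma second_countable_atlas_topology:
  fixes A :: "('i, 'e::euclidean_space, 'p) atlas"
  assumes A: "pts A = (\<Union>i\<in>charts A. cpar A i ` cdom A i)"
    "\<And>i j. i \<in> charts A \<Longrightarrow> j \<in> charts A \<Longrightarrow>
       open (overlap A i j) \<and> continuous_on (overlap A i j) (transition A i j)"
    "\<And>i. i \<in> charts A \<Longrightarrow> inj_on (cpar A i) (cdom A i)"
    "\<And>i. i \<in> charts A \<Longrightarrow> open (cdom A i)"
    and c: "countable (charts A)"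
  shows "second_countable (atlas_topology A)"
proof -
  obtain \<B> :: "'e set set" where \<B>: "countable \<B>" "topological_basis \<B>"
    using ex_countable_basis by blast
  define \<C> where "\<C> = (\<lambda>(i, B). cpar A i ` (B \<inter> cdom A i)) ` (charts A \<times> \<B>)"
  show ?thesis
    unfolding second_countable_def
  proof (intro exI conjI ballI allI impI)
    show "countable \<C>" unfolding \<C>_def using c \<B> by auto
    show "openin (atlas_topology A) V" if V\<C>: "V \<in> \<C>" for V
    proof -
      obtain i B where i: "i \<in> charts A" and B: "B \<in> \<B>" and V: "V = cpar A i ` (B \<inter> cdom A i)"
        using V\<C> unfolding \<C>_def by fast
      have "open (B \<inter> cdom A i)" using A(4)[OF i] topological_basis_open[OF \<B>(2) B] by blast
      then show ?thesis unfolding V by (intro openin_chart_image[OF A(1-3)] i) auto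
    qed
    fix U p assume U: "openin (atlas_topology A) U \<and> p \<in> U"
    then obtain i x where x: "i \<in> charts A" "x \<in> cdom A i" "p = cpar A i x"
      using A(1) by (auto simp: openin_atlas_topology)
    then obtain B where B: "B \<in> \<B>" "x \<in> B" "B \<subseteq> {x \<in> cdom A i. cpar A i x \<in> U}"
      using U topological_basisE[OF \<B>(2) openin_chart_preimage[of A U i], of x] by blast
    show "\<exists>V\<in>\<C>. p \<in> V \<and> V \<subseteq> U"
      by (rule bexI[of _ "cpar A i ` (B \<inter> cdom A i)"]) (use B x in \<open>auto simp: \<C>_def\<close>)
  qed
qed

section \<open>The blow-up as a smooth manifold\<close>

lemma blowup_simps:
  "pts blowup = {(z, L). L \<in> CP1 \<and> z \<in> L}" "charts blowup = UNIV" "cdom blowup i = UNIV"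
  "cpar blowup True x = ((fst x, fst x * snd x), cline (1, snd x))"
  "cpar blowup False x = ((fst x * snd x, fst x), cline (snd x, 1))"
  by (simp_all add: blowup_def case_prod_unfold)

lemma mem_cline: "w \<in> cline v \<longleftrightarrow> (\<exists>c. w = (c * fst v, c * snd v))"
  by (auto simp: cline_def cscale_def)

lemma cline_cscale:
  assumes "c \<noteq> 0" shows "cline (cscale c v) = cline v"
proof (intro equalityI subsetI)
  fix w assume "w \<in> cline v"
  then obtain d where "w = (d * fst v, d * snd v)" by (auto simp: mem_cline)
  then have "w = (d / c * fst (cscale c v), d / c * snd (cscale c v))"
    using assms by (simp add: cscale_def)
  then show "w \<in> cline (cscale c v)" unfolding mem_cline by blast
next
  fix w assume "w \<in> cline (cscale c v)"
  then obtain d where "w = (d * (c * fst v), d * (c * snd v))"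
    unfolding mem_cline by (auto simp only: cscale_def fst_conv snd_conv)
  then have "w = (d * c * fst v, d * c * snd v)" by simp
  then show "w \<in> cline v" unfolding mem_cline by blast
qed

lemma cline_eqD:
  assumes "cline v = cline w" shows "fst v * snd w = snd v * fst w"
proof -
  have "v \<in> cline v" unfolding mem_cline by (rule exI[of _ 1]) simp
  then show ?thesis using assms by (auto simp: mem_cline)
qed

lemma cline_eq_chart: "b * d = 1 \<Longrightarrow> cline (1, b) = cline (d, 1)"
  using cline_cscale[of b "(d, 1)"] by (force simp: cscale_def)

text \<open>The lines \<open>[1 : b]\<close> and \<open>[d : 1]\<close> agree iff \<open>b d = 1\<close>.  By the symmetry of this condition the
  transition in both directions is \<open>(a, b) \<mapsto> (a b, 1 / b)\<close>.\<close>

lemma cpar_eq_iff: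
  assumes "i \<noteq> j"
  shows "cpar blowup i x = cpar blowup j y \<longleftrightarrow> snd x * snd y = 1 \<and> fst y = fst x * snd x"
proof -
  have 1: "cpar blowup True x = cpar blowup False y \<longleftrightarrow> snd x * snd y = 1 \<and> fst y = fst x * snd x" for x y
  proof
    assume "cpar blowup True x = cpar blowup False y"
    then show "snd x * snd y = 1 \<and> fst y = fst x * snd x"
      using cline_eqD[of "(1, snd x)" "(snd y, 1)"] by (simp add: blowup_simps mult.commute)
  next
    assume *: "snd x * snd y = 1 \<and> fst y = fst x * snd x"
    then have "fst x = fst y * snd y" by (simp add: mult.assoc)
    then show "cpar blowup True x = cpar blowup False y"
      using * cline_eq_chart[of "snd x" "snd y"] by (simp add: blowup_simps)
  qed
  have 2: "snd x * snd y = 1 \<and> fst y = fst x * snd x \<longleftrightarrow> snd y * snd x = 1 \<and> fst x = fst y * snd y"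
    by (smt (verit) mult.assoc mult.commute mult.right_neutral)
  show ?thesis
  proof (cases i)
    case True
    then show ?thesis using assms 1[of x y] by simp
  next
    case False
    then show ?thesis using assms 1[of y x] 2 by (metis (full_types))
  qed
qed

lemma inj_cpar_blowup: "inj (cpar blowup i)"
proof (rule injI)
  fix x y assume *: "cpar blowup i x = cpar blowup i y"
  show "x = y"
  proof (cases i)
    case True
    then show ?thesis using * cline_eqD[of "(1, snd x)" "(1, snd y)"] by (auto simp: blowup_simps prod_eq_iff)
  next
    case False
    then show ?thesis using * cline_eqD[of "(snd x, 1)" "(snd y, 1)"] by (auto simp: blowup_simps prod_eq_iff)
  qed
qed

lemma pts_blowup_eq: "pts blowup = (\<Union>i. range (cpar blowup i))"
proof (intro equalityI subsetI)
  fix p assume "p \<in> pts blowup"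
  then obtain z v where p: "p = (z, cline v)" "v \<noteq> 0" "z \<in> cline v"
    by (auto simp: blowup_simps CP1_def)
  then obtain c where c: "z = (c * fst v, c * snd v)" by (auto simp: mem_cline)
  show "p \<in> (\<Union>i. range (cpar blowup i))"
  proof (cases "fst v = 0")
    case False
    have "v = cscale (fst v) (1, snd v / fst v)" using False by (simp add: cscale_def)
    then have "cline v = cline (1, snd v / fst v)" using cline_cscale[OF False] by metis
    then have "p = cpar blowup True (c * fst v, snd v / fst v)"
      using False by (simp add: p(1) c blowup_simps)
    then show ?thesis by blast
  next
    case True
    then have nz: "snd v \<noteq> 0" using p(2) by (auto simp: prod_eq_iff)
    have "v = cscale (snd v) (fst v / snd v, 1)" using nz by (simp add: cscale_def)
    then have "cline v = cline (fst v / snd v, 1)" using cline_cscale[OF nz] by metis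
    then have "p = cpar blowup False (c * snd v, fst v / snd v)"
      using nz by (simp add: p(1) c blowup_simps)
    then show ?thesis by blast
  qed
next
  fix p assume "p \<in> (\<Union>i. range (cpar blowup i))"
  then obtain i x where "p = cpar blowup i x" by auto
  moreover have "(1 :: complex, snd x) \<noteq> 0" "(snd x, 1 :: complex) \<noteq> 0" by (auto simp: prod_eq_iff)
  ultimately show "p \<in> pts blowup"
    by (cases i) (auto simp: blowup_simps CP1_def mem_cline)
qed

lemma overlap_blowup_self: "overlap blowup i i = UNIV"
  by (auto simp: overlap_def blowup_simps)

lemma overlap_blowup:
  assumes "i \<noteq> j" shows "overlap blowup i j = {x. snd x \<noteq> 0}"
proof -
  have "(\<exists>y. cpar blowup i x = cpar blowup j y) \<longleftrightarrow> snd x \<noteq> 0" for x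
  proof
    assume "snd x \<noteq> 0"
    then have "cpar blowup i x = cpar blowup j (fst x * snd x, inverse (snd x))"
      using cpar_eq_iff[OF assms] by simp
    then show "\<exists>y. cpar blowup i x = cpar blowup j y" by blast
  qed (use cpar_eq_iff[OF assms, of x] in auto)
  then show ?thesis by (auto simp: overlap_def blowup_simps(3) image_iff)
qed

lemma transition_blowup_self: "transition blowup i i x = x"
  using transition_self[of blowup i x] inj_cpar_blowup by (simp add: blowup_simps)

lemma dtransition_blowup_self: "dtransition blowup i i x u = u"
  using dtransition_self[of blowup i x u] inj_cpar_blowup by (simp add: blowup_simps)

lemma transition_blowup:
  assumes "i \<noteq> j" "snd x \<noteq> 0"
  shows "transition blowup i j x = (fst x * snd x, inverse (snd x))"
proof (rule transition_eqI)
  have "cpar blowup i x = cpar blowup j (fst x * snd x, inverse (snd x))"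
    using assms cpar_eq_iff[OF assms(1)] by simp
  then show "cpar blowup j (fst x * snd x, inverse (snd x)) = cpar blowup i x" by simp
qed (simp_all add: blowup_simps(3) inj_cpar_blowup)

lemma open_snd_neq_0: "open {x :: C2. snd x \<noteq> 0}"
  by (intro open_Collect_neq continuous_intros)

lemma open_fst_neq_0: "open {x :: C2. fst x \<noteq> 0}"
  by (intro open_Collect_neq continuous_intros)

lemma dtransition_blowup:
  assumes "i \<noteq> j" "snd x \<noteq> 0"
  shows "dtransition blowup i j x u = (fst u * snd x + fst x * snd u, - snd u / (snd x)\<^sup>2)"
proof -
  have "frechet_derivative (transition blowup i j) (at x) =
      frechet_derivative (\<lambda>x. (fst x * snd x, inverse (snd x))) (at x)"
    by (rule frechet_derivative_cong_open[OF open_snd_neq_0])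
       (use assms in \<open>auto simp: transition_blowup\<close>)
  moreover have "((\<lambda>x::C2. (fst x * snd x, inverse (snd x))) has_derivative
      (\<lambda>u. (fst u * snd x + fst x * snd u, - snd u / (snd x)\<^sup>2))) (at x)"
    by (auto intro!: derivative_eq_intros simp: assms power2_eq_square divide_inverse fun_eq_iff)
  ultimately show ?thesis unfolding dtransition_def by (simp flip: frechet_derivative_at)
qed

lemma smooth_transition_blowup:
  "open (overlap blowup i j) \<and> smooth_on (overlap blowup i j) (transition blowup i j)"
proof (cases "i = j")
  case True
  have "smooth_on UNIV (transition blowup i i)"
    using smooth_on_cong_open[of UNIV "transition blowup i i" "\<lambda>x. x"] smooth_on_id[of UNIV]
    by (simp add: transition_blowup_self)
  then show ?thesis using True by (simp add: overlap_blowup_self)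
next
  case False
  have "smooth_on {x. snd x \<noteq> 0} (\<lambda>x::C2. (fst x * snd x, inverse (snd x)))"
    by (intro smooth_intros open_snd_neq_0) auto
  then have "smooth_on {x. snd x \<noteq> 0} (transition blowup i j)"
    using smooth_on_cong_open[OF open_snd_neq_0, of "transition blowup i j"
        "\<lambda>x::C2. (fst x * snd x, inverse (snd x))"] transition_blowup[OF False] by blast
  then show ?thesis using False by (simp add: overlap_blowup open_snd_neq_0)
qed

text \<open>Points in a common chart are separated there.  Two points without a common chart lie over
  the lines \<open>[1 : 0]\<close> and \<open>[0 : 1]\<close>, and then the sets \<open>|b| < 1\<close> of the two charts separate them because
  the second coordinates of the two charts are inverse to each other.\<close>

lemma Hausdorff_blowup: "Hausdorff_space (atlas_topology blowup)"
  unfolding Hausdorff_space_def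
proof (intro allI impI)
  fix p q assume pq: "p \<in> topspace (atlas_topology blowup) \<and> q \<in> topspace (atlas_topology blowup) \<and> p \<noteq> q"
  have op: "openin (atlas_topology blowup) (cpar blowup i ` B)" if "open B" for i B
    using that inj_cpar_blowup[of i] smooth_transition_blowup
    by (intro openin_chart_image) (auto simp: pts_blowup_eq blowup_simps(2,3) inj_cpar_blowup
        intro: smooth_on_imp_continuous_on)
  have "topspace (atlas_topology blowup) \<subseteq> pts blowup"
    using openin_topspace[of "atlas_topology blowup"] unfolding openin_atlas_topology by blast
  then obtain i x j y where p: "p = cpar blowup i x" and q: "q = cpar blowup j y"
    using pq unfolding pts_blowup_eq by blast
  have same_chart: "\<exists>U V. openin (atlas_topology blowup) U \<and> openin (atlas_topology blowup) V \<and>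
      p \<in> U \<and> q \<in> V \<and> disjnt U V"
    if p: "p = cpar blowup k x" and q: "q = cpar blowup k y" for k x y
  proof -
    have "x \<noteq> y" using p q pq by auto
    then obtain B C where "open B" "open C" "x \<in> B" "y \<in> C" "B \<inter> C = {}" by (meson hausdorff)
    then have "p \<in> cpar blowup k ` B" "q \<in> cpar blowup k ` C"
      "disjnt (cpar blowup k ` B) (cpar blowup k ` C)"
      using p q injD[OF inj_cpar_blowup[of k]] unfolding disjnt_def by blast+
    then show ?thesis using op[OF \<open>open B\<close>, of k] op[OF \<open>open C\<close>, of k] by blast
  qed
  show "\<exists>U V. openin (atlas_topology blowup) U \<and> openin (atlas_topology blowup) V \<and>
      p \<in> U \<and> q \<in> V \<and> disjnt U V"
  proof (cases "p \<in> range (cpar blowup j) \<or> q \<in> range (cpar blowup i)")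
    case True
    then show ?thesis using same_chart p q by blast
  next
    case False
    then have ij: "i \<noteq> j" using p by auto
    have x0: "snd x = 0" using False overlap_blowup[OF ij] by (auto simp: p overlap_def blowup_simps(3))
    have y0: "snd y = 0" using False overlap_blowup[OF ij[symmetric]] by (auto simp: q overlap_def blowup_simps(3))
    let ?B = "{x :: C2. norm (snd x) < 1}"
    have "open ?B" by (intro open_Collect_less continuous_intros)
    have ne: "cpar blowup i x \<noteq> cpar blowup j y" if "x \<in> ?B" "y \<in> ?B" for x y
    proof
      assume "cpar blowup i x = cpar blowup j y"
      then have "norm (snd x) * norm (snd y) = 1"
        using cpar_eq_iff[OF ij] by (metis norm_mult norm_one)
      moreover have "norm (snd x) * norm (snd y) < 1 * 1"
        using that by (intro mult_strict_mono') auto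
      ultimately show False by simp
    qed
    have "disjnt (cpar blowup i ` ?B) (cpar blowup j ` ?B)"
      unfolding disjnt_def using ne by blast
    moreover have "x \<in> ?B" "y \<in> ?B" using x0 y0 by simp_all
    ultimately show ?thesis using p q op[OF \<open>open ?B\<close>] by blast
  qed
qed

lemma smooth_manifold_blowup: "smooth_manifold blowup"
proof -
  have "second_countable (atlas_topology blowup)"
    using smooth_transition_blowup inj_cpar_blowup
    by (intro second_countable_atlas_topology) (auto simp: pts_blowup_eq blowup_simps(2,3)
        intro: smooth_on_imp_continuous_on)
  then show ?thesis
    using smooth_transition_blowup inj_cpar_blowup Hausdorff_blowup
    by (auto simp: smooth_manifold_def pts_blowup_eq blowup_simps(2,3))
qed

section \<open>The Burns metric in a chart\<close>

text \<open>The squared norm \<open>s\<close> of the vector \<open>(1, b)\<close> that spans the line.  It and the next function are real;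
  they are complex-valued here so that identities between Wirtinger derivatives are polynomial
  identities in the coordinates and their conjugates.\<close>

definition line_sq :: "C2 \<Rightarrow> complex" where
  "line_sq x = 1 + snd x * cnj (snd x)"

text \<open>\<open>P = \<parallel>z\<parallel>\<^sup>2 + m\<close>.  On the divisor it is the constant \<open>m > 0\<close>.\<close>

definition radial :: "real \<Rightarrow> C2 \<Rightarrow> complex" where
  "radial m x = line_sq x * (fst x * cnj (fst x)) + of_real m"

text \<open>The complex Hessian of \<open>s |a|\<^sup>2 + m ln s\<close>.\<close>

definition burns_herm :: "real \<Rightarrow> C2 \<Rightarrow> C2 \<Rightarrow> C2 \<Rightarrow> complex" where
  "burns_herm m x v w = line_sq x * (fst v * cnj (fst w)) + cnj (fst x) * snd x * (fst v * cnj (snd w))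
     + fst x * cnj (snd x) * (snd v * cnj (fst w))
     + (fst x * cnj (fst x) + of_real m / (line_sq x)\<^sup>2) * (snd v * cnj (snd w))"

definition burns :: "real \<Rightarrow> C2 bilin" where
  "burns m x v w = 2 * Re (burns_herm m x v w)"

text \<open>The component of \<open>v\<close> along the fibre, for the decomposition into the fibre and its orthogonal
  complement.\<close>

definition vert :: "C2 \<Rightarrow> C2 \<Rightarrow> complex" where
  "vert x v = fst v + fst x * cnj (snd x) / line_sq x * snd v"

text \<open>The derivative of \<open>burns_herm\<close> at \<open>x\<close> by the \<open>(1, 0)\<close> part of \<open>u\<close>.  Its symmetry in \<open>u\<close> and \<open>v\<close> is the
  Kaehler condition.\<close>

definition del_herm :: "real \<Rightarrow> C2 \<Rightarrow> C2 \<Rightarrow> C2 \<Rightarrow> C2 \<Rightarrow> complex" where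
  "del_herm m x u v w = cnj (snd x) * (snd u * fst v + fst u * snd v) * cnj (fst w)
     + (cnj (fst x) * (snd u * fst v + fst u * snd v)
        - 2 * of_real m * cnj (snd x) / (line_sq x) ^ 3 * (snd u * snd v)) * cnj (snd w)"

text \<open>The Christoffel symbols, complex bilinear as for every Kaehler metric.\<close>

definition burns_gamma :: "real \<Rightarrow> C2 \<Rightarrow> C2 \<Rightarrow> C2 \<Rightarrow> C2" where
  "burns_gamma m x u v =
     ((fst u * snd v + snd u * fst v) * (of_real m * cnj (snd x) / (line_sq x * radial m x))
        + snd u * snd v * (2 * of_real m * fst x * (cnj (snd x))\<^sup>2 / ((line_sq x)\<^sup>2 * radial m x)),
      (fst u * snd v + snd u * fst v) * (line_sq x * cnj (fst x) / radial m x)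
        - snd u * snd v * (2 * of_real m * cnj (snd x) / (line_sq x * radial m x)))"

lemma line_sq_real: "line_sq x = of_real (1 + (cmod (snd x))\<^sup>2)"
  unfolding line_sq_def of_real_add of_real_1 complex_norm_square ..

lemma radial_real: "radial m x = of_real ((1 + (cmod (snd x))\<^sup>2) * (cmod (fst x))\<^sup>2 + m)"
  unfolding radial_def line_sq_real of_real_add of_real_mult complex_norm_square ..

lemma line_sq_pos: "Re (line_sq x) > 0" unfolding line_sq_real Re_complex_of_real by (simp add: add_pos_nonneg)

lemma radial_pos: "m > 0 \<Longrightarrow> Re (radial m x) > 0"
  unfolding radial_real Re_complex_of_real by (simp add: add_nonneg_pos)

lemma line_sq_nz [simp]: "line_sq x \<noteq> 0" using line_sq_pos[of x] by auto

lemma radial_nz: "m > 0 \<Longrightarrow> radial m x \<noteq> 0" using radial_pos[of m x] by auto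

lemma cnj_line_sq [simp]: "cnj (line_sq x) = line_sq x" by (simp add: line_sq_real)

lemma snd_cnj_snd: "snd x * cnj (snd x) = line_sq x - 1" by (simp add: line_sq_def)

lemma has_derivative_cnj' [derivative_intros]:
  "(f has_derivative f') F \<Longrightarrow> ((\<lambda>x. cnj (f x)) has_derivative (\<lambda>x. cnj (f' x))) F"
  by (rule bounded_linear.has_derivative[OF bounded_linear_cnj])

lemma line_sq_has_derivative:
  "(line_sq has_derivative (\<lambda>u. snd u * cnj (snd x) + snd x * cnj (snd u))) (at x)"
  unfolding line_sq_def[abs_def]
  by (auto intro!: derivative_eq_intros simp: algebra_simps)

text \<open>\<open>P\<close> has no horizontal derivative; this is what makes its gradient tangent to the fibres.\<close>

lemma radial_has_derivative:
  "(radial m has_derivative (\<lambda>u. line_sq x * (cnj (fst x) * vert x u + fst x * cnj (vert x u)))) (at x)"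
  unfolding radial_def[abs_def] vert_def
  by (rule derivative_eq_intros line_sq_has_derivative refl)+
     (simp add: algebra_simps fun_eq_iff)

text \<open>Completing the square with respect to the first component.\<close>

lemma burns_herm_adapted:
  "burns_herm m x v w = line_sq x * vert x v * cnj (vert x w) + radial m x / (line_sq x)\<^sup>2 * (snd v * cnj (snd w))"
proof -
  define k where "k = fst x * cnj (snd x) / line_sq x"
  have k: "line_sq x * k = fst x * cnj (snd x)" "line_sq x * cnj k = cnj (fst x) * snd x"
    by (simp_all add: k_def)
  have "line_sq x * k * cnj k = (fst x * cnj (fst x)) * (snd x * cnj (snd x)) / line_sq x"
    by (simp add: k_def)
  also have "\<dots> = fst x * cnj (fst x) - fst x * cnj (fst x) / line_sq x"
    unfolding snd_cnj_snd by (simp add: right_diff_distrib diff_divide_distrib)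
  moreover have "radial m x / (line_sq x)\<^sup>2 = fst x * cnj (fst x) / line_sq x + of_real m / (line_sq x)\<^sup>2"
    by (simp add: radial_def add_divide_distrib power2_eq_square)
  ultimately have "fst x * cnj (fst x) + of_real m / (line_sq x)\<^sup>2 = line_sq x * k * cnj k + radial m x / (line_sq x)\<^sup>2"
    by simp
  then show ?thesis unfolding burns_herm_def vert_def k_def[symmetric] using k
    by (simp only: complex_cnj_add complex_cnj_mult) algebra
qed

text \<open>The complex form of Koszul's formula: the Christoffel symbols are the derivative of the metric
  with one index raised.\<close>

lemma burns_herm_gamma:
  assumes "m > 0"
  shows "burns_herm m x (burns_gamma m x u v) w = del_herm m x u v w"
proof -
  define a b A B s P M where ab: "a = fst x" "b = snd x" "A = cnj (fst x)" "B = cnj (snd x)"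
    "s = line_sq x" "P = radial m x" "M = complex_of_real m"
  define X Y where XY: "X = fst u * snd v + snd u * fst v" "Y = snd u * snd v"
  have bB: "b * B = s - 1" and P: "P = s * (a * A) + M" and nz: "s \<noteq> 0" "P \<noteq> 0"
    using radial_nz[OF assms] by (auto simp: ab snd_cnj_snd radial_def)
  (* The two coefficients, of the conjugates of fst w and snd w. *)
  have 1: "s * (X * (M * B / (s * P)) + Y * (2 * M * a * B\<^sup>2 / (s\<^sup>2 * P)))
     + a * B * (X * (s * A / P) - Y * (2 * M * B / (s * P))) = B * X"
    using nz by (simp add: field_simps power2_eq_square) (simp add: P algebra_simps)
  have 2: "A * b * (X * (M * B / (s * P)) + Y * (2 * M * a * B\<^sup>2 / (s\<^sup>2 * P)))
     + (a * A + M / s\<^sup>2) * (X * (s * A / P) - Y * (2 * M * B / (s * P))) = A * X - 2 * M * B / s ^ 3 * Y"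
    using nz apply (simp add: field_simps power2_eq_square power3_eq_cube) 
    using bB P apply algebra done
  show ?thesis
    unfolding burns_herm_def del_herm_def burns_gamma_def fst_conv snd_conv using 1 2
    unfolding ab XY by algebra
qed

lemma line_sq_power_has_derivative:
  "((\<lambda>y. c / (line_sq y)\<^sup>2) has_derivative
      (\<lambda>u. - 2 * c * (snd u * cnj (snd x) + snd x * cnj (snd u)) / (line_sq x) ^ 3)) (at x)"
  by (auto intro!: derivative_eq_intros line_sq_has_derivative
      simp: fun_eq_iff power2_eq_square power3_eq_cube divide_simps)

lemma burns_herm_has_derivative:
  "((\<lambda>y. burns_herm m y v w) has_derivative (\<lambda>u. del_herm m x u v w + cnj (del_herm m x u w v))) (at x)"
  unfolding burns_herm_def[abs_def]
  by (rule line_sq_power_has_derivative derivative_eq_intros line_sq_has_derivative refl)+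
     (simp add: fun_eq_iff del_herm_def add_divide_distrib diff_divide_distrib algebra_simps)

lemma cnj_burns_herm: "cnj (burns_herm m x v w) = burns_herm m x w v"
  by (simp add: burns_herm_def mult_ac)

lemma burns_herm_scale:
  "burns_herm m x (cscale c v) w = c * burns_herm m x v w" "burns_herm m x v (cscale c w) = cnj c * burns_herm m x v w"
  by (simp_all add: burns_herm_def cscale_def algebra_simps)

lemma burns_herm_add:
  "burns_herm m x (u + v) w = burns_herm m x u w + burns_herm m x v w" "burns_herm m x v (u + w) = burns_herm m x v u + burns_herm m x v w"
  by (simp_all add: burns_herm_def algebra_simps)

lemma burns_self:
  "burns m x v v = 2 * (Re (line_sq x) * (cmod (vert x v))\<^sup>2 + Re (radial m x) / (Re (line_sq x))\<^sup>2 * (cmod (snd v))\<^sup>2)"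
proof -
  have "line_sq x = of_real (Re (line_sq x))" "radial m x = of_real (Re (radial m x))"
    by (simp_all add: line_sq_real radial_real)
  then obtain s P where s: "line_sq x = of_real s" "radial m x = of_real P" by blast
  have "burns_herm m x v v = of_real (s * (cmod (vert x v))\<^sup>2 + P / s\<^sup>2 * (cmod (snd v))\<^sup>2)"
    unfolding burns_herm_adapted s of_real_add of_real_mult complex_norm_square by (simp add: mult_ac)
  then show ?thesis by (simp add: burns_def s)
qed

lemma burns_pos:
  assumes "m > 0" "v \<noteq> 0" shows "burns m x v v > 0"
proof -
  have *: "Re (line_sq x) > 0" "Re (radial m x) / (Re (line_sq x))\<^sup>2 > 0"
    using line_sq_pos[of x] radial_pos[OF assms(1)] by auto
  show ?thesis
  proof (cases "snd v = 0")
    case True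
    then have "vert x v \<noteq> 0" using assms(2) by (auto simp: vert_def prod_eq_iff)
    then show ?thesis using * True unfolding burns_self by simp
  next
    case False
    then show ?thesis using * unfolding burns_self
      by (intro mult_pos_pos add_nonneg_pos mult_nonneg_nonneg) auto
  qed
qed

lemma burns_sym: "burns m x v w = burns m x w v"
  unfolding burns_def using cnj_burns_herm[of m x v w] by (metis cnj.sel(1))

lemma linear_burns: "linear (burns m x v)"
proof (rule linearI)
  fix r :: real and w
  have "r *\<^sub>R w = cscale (of_real r) w" by (simp add: cscale_def prod_eq_iff scaleR_conv_of_real)
  then show "burns m x v (r *\<^sub>R w) = r *\<^sub>R burns m x v w" by (simp add: burns_def burns_herm_scale)
qed (simp add: burns_def burns_herm_add)

lemma burns_nondegenerate:
  assumes "m > 0" "\<And>w. burns m x v w = burns m x v' w"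
  shows "v = v'"
proof (rule ccontr)
  assume "v \<noteq> v'"
  then have "burns m x (v - v') (v - v') > 0" using burns_pos[OF assms(1)] by simp
  moreover have "burns m x (v - v') (v - v') = burns m x v (v - v') - burns m x v' (v - v')"
    using linear_diff[OF linear_burns, of m x "v - v'"] by (simp add: burns_sym)
  ultimately show False using assms(2) by simp
qed

lemma smooth_line_sq [smooth_intros]: "open S \<Longrightarrow> smooth_on S line_sq"
  unfolding line_sq_def[abs_def] by (intro smooth_intros)

lemma smooth_radial [smooth_intros]: "open S \<Longrightarrow> smooth_on S (radial m)"
  unfolding radial_def[abs_def] by (intro smooth_intros)

lemma smooth_burns: "open S \<Longrightarrow> smooth_on S (\<lambda>x. burns m x v w)"
  unfolding burns_def burns_herm_def by (intro smooth_intros) auto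

lemma riemannian_burns:
  assumes "m > 0" "open S" shows "riemannian_on S (burns m)"
  unfolding riemannian_on_def
  using smooth_burns[OF assms(2)] linear_burns burns_sym burns_pos[OF assms(1)] by blast

lemma burns_has_derivative:
  "((\<lambda>y. burns m y v w) has_derivative (\<lambda>u. 2 * Re (del_herm m x u v w + del_herm m x u w v))) (at x)"
proof -
  have "((\<lambda>y. burns m y v w) has_derivative (\<lambda>u. 2 * Re (del_herm m x u v w + cnj (del_herm m x u w v)))) (at x)"
    unfolding burns_def by (intro has_derivative_mult_right has_derivative_Re burns_herm_has_derivative)
  then show ?thesis by simp
qed

lemma pderivative_burns:
  "pderivative (\<lambda>y. burns m y v w) x u = 2 * Re (del_herm m x u v w + del_herm m x u w v)"
  by (rule pderivativeI[OF burns_has_derivative])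

lemma del_herm_sym: "del_herm m x u v w = del_herm m x v u w"
  by (simp add: del_herm_def algebra_simps)

lemma del_herm_cscale: "del_herm m x u (cscale c v) w = c * del_herm m x u v w" "del_herm m x (cscale c u) v w = c * del_herm m x u v w"
    "del_herm m x u v (cscale c w) = cnj c * del_herm m x u v w"
  by (simp_all add: del_herm_def cscale_def algebra_simps)

text \<open>In Koszul's formula four of the six terms cancel by symmetry of \<open>del_herm\<close>.\<close>

lemma christoffel_burns:
  assumes "m > 0" shows "christoffel (burns m) x u v = burns_gamma m x u v"
  unfolding christoffel_def
proof (rule the_equality)
  have "2 * burns m x (burns_gamma m x u v) w =
      pderivative (\<lambda>y. burns m y v w) x u + pderivative (\<lambda>y. burns m y u w) x v
      - pderivative (\<lambda>y. burns m y u v) x w" for w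
    using del_herm_sym[of m x u v w] del_herm_sym[of m x u w v] del_herm_sym[of m x v w u]
    by (simp add: pderivative_burns) (simp add: burns_def burns_herm_gamma[OF assms])
  then show *: "\<forall>w. 2 * burns m x (burns_gamma m x u v) w =
      pderivative (\<lambda>y. burns m y v w) x u + pderivative (\<lambda>y. burns m y u w) x v
      - pderivative (\<lambda>y. burns m y u v) x w" by blast
  fix c assume "\<forall>w. 2 * burns m x c w =
      pderivative (\<lambda>y. burns m y v w) x u + pderivative (\<lambda>y. burns m y u w) x v
      - pderivative (\<lambda>y. burns m y u v) x w"
  with * have "burns m x c w = burns m x (burns_gamma m x u v) w" for w
    by (metis mult_cancel_left zero_neq_numeral)
  then show "c = burns_gamma m x u v" by (rule burns_nondegenerate[OF assms])
qed

lemma J_std_burns: "burns m x (J_std x u) (J_std x v) = burns m x u v"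
  by (simp add: J_std_def burns_def burns_herm_scale)

lemma almost_complex_J_std: "almost_complex_on S J_std"
  unfolding almost_complex_on_def J_std_def
  by (auto intro!: smooth_intros linearI simp: cscale_def algebra_simps)

lemma nijenhuis_J_std: "nijenhuis J_std x u v = 0"
  unfolding nijenhuis_def lie_bracket_def J_std_def
  by (simp add: pderivative_def cscale_def zero_prod_def)

lemma kahler_burns:
  assumes "m > 0" "open S" shows "kahler_on S (burns m) J_std"
proof -
  have "ext_deriv2 (kform (burns m) J_std) x u v w = 0" for x u v w
    using del_herm_sym[of m x u v w] del_herm_sym[of m x u w v] del_herm_sym[of m x v w u]
    by (simp add: ext_deriv2_def kform_def J_std_def pderivative_burns del_herm_cscale)
  then show ?thesis
    using riemannian_burns[OF assms] almost_complex_J_std J_std_burns nijenhuis_J_std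
    unfolding kahler_on_def hermitian_on_def by blast
qed

section \<open>Existence and uniqueness of the Burns metric\<close>

lemma wirtinger_eqI:
  assumes "(f has_derivative
      (\<lambda>u. p1 * fst u + p2 * snd u + q1 * cnj (fst u) + q2 * cnj (snd u))) (at z)"
  shows "wirtinger j f z = (if j = 1 then p1 else p2)"
    and "wirtinger_bar j f z = (if j = 1 then q1 else q2)"
  unfolding wirtinger_def wirtinger_bar_def pderivativeI[OF assms]
  by (auto simp: cbasis_def cscale_def algebra_simps)

lemma wirtinger_cong_open:
  assumes "open S" "z \<in> S" "\<And>y. y \<in> S \<Longrightarrow> f y = h y"
  shows "wirtinger j f z = wirtinger j h z"
  unfolding wirtinger_def using pderivative_cong_open[OF assms] by simp

definition norm_sq :: "C2 \<Rightarrow> complex" where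
  "norm_sq z = fst z * cnj (fst z) + snd z * cnj (snd z)"

lemma norm_sq_norm: "norm_sq z = of_real ((norm z)\<^sup>2)"
proof -
  have "(norm z)\<^sup>2 = (cmod (fst z))\<^sup>2 + (cmod (snd z))\<^sup>2" by (simp add: norm_prod_def)
  then show ?thesis by (simp only: norm_sq_def of_real_add complex_norm_square)
qed

lemma wirtinger_bar_burns_potential:
  assumes "z \<noteq> 0"
  shows "wirtinger_bar k (burns_potential m) z = ccoord k z * (1 + of_real m / norm_sq z)"
proof -
  have n: "norm z > 0" using assms by simp
  have "((\<lambda>z::C2. (norm z)\<^sup>2 + m * ln ((norm z)\<^sup>2)) has_derivative
     (\<lambda>u. 2 * (z \<bullet> u) + m * (2 * (z \<bullet> u) / (norm z)\<^sup>2))) (at z)"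
    unfolding power2_norm_eq_inner using assms
    by (auto intro!: derivative_eq_intros simp: inner_commute fun_eq_iff divide_simps)
  then have "(burns_potential m has_derivative
     (\<lambda>u. of_real (2 * (z \<bullet> u) + m * (2 * (z \<bullet> u) / (norm z)\<^sup>2)))) (at z)"
    unfolding burns_potential_def[abs_def] by (rule has_derivative_of_real)
  moreover have "complex_of_real (2 * (z \<bullet> u) + m * (2 * (z \<bullet> u) / (norm z)\<^sup>2)) =
      cnj (fst z) * (1 + of_real m / norm_sq z) * fst u + cnj (snd z) * (1 + of_real m / norm_sq z) * snd u
      + fst z * (1 + of_real m / norm_sq z) * cnj (fst u) + snd z * (1 + of_real m / norm_sq z) * cnj (snd u)"
    for u
  proof -
    have *: "complex_of_real (2 * (z \<bullet> u)) =
        cnj (fst z) * fst u + cnj (snd z) * snd u + fst z * cnj (fst u) + snd z * cnj (snd u)"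
      by (simp add: inner_prod_def inner_complex_def complex_eq_iff algebra_simps)
    have "complex_of_real (2 * (z \<bullet> u) + m * (2 * (z \<bullet> u) / (norm z)\<^sup>2)) =
        complex_of_real (2 * (z \<bullet> u)) * (1 + of_real m / norm_sq z)"
      by (simp add: norm_sq_norm algebra_simps)
    then show ?thesis unfolding * by (simp add: algebra_simps)
  qed
  ultimately have "(burns_potential m has_derivative
     (\<lambda>u. cnj (fst z) * (1 + of_real m / norm_sq z) * fst u + cnj (snd z) * (1 + of_real m / norm_sq z) * snd u
      + fst z * (1 + of_real m / norm_sq z) * cnj (fst u) + snd z * (1 + of_real m / norm_sq z) * cnj (snd u))) (at z)"
    by (auto elim!: has_derivative_eq_rhs)
  from wirtinger_eqI(2)[OF this] show ?thesis by (simp add: ccoord_def)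
qed

lemma norm_sq_nz: "z \<noteq> 0 \<Longrightarrow> norm_sq z \<noteq> 0" by (simp add: norm_sq_norm)

lemma norm_sq_has_derivative:
  "(norm_sq has_derivative (\<lambda>u. fst u * cnj (fst z) + fst z * cnj (fst u)
      + (snd u * cnj (snd z) + snd z * cnj (snd u)))) (at z)"
  unfolding norm_sq_def[abs_def] by (auto intro!: derivative_eq_intros)

lemma wirtinger_wirtinger_bar_burns_potential:
  assumes "z \<noteq> 0"
  shows "wirtinger j (wirtinger_bar k (burns_potential m)) z =
    (if (j = 1) = (k = 1) then 1 + of_real m / norm_sq z else 0)
    - of_real m * ccoord k z * cnj (ccoord j z) / (norm_sq z)\<^sup>2"
proof -
  have o: "open {z :: C2. z \<noteq> 0}" by (intro open_Collect_neq continuous_intros)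
  have inv: "((\<lambda>z. 1 + of_real m / norm_sq z) has_derivative (\<lambda>u. - of_real m *
        (fst u * cnj (fst z) + fst z * cnj (fst u) + (snd u * cnj (snd z) + snd z * cnj (snd u))) / (norm_sq z)\<^sup>2)) (at z)"
    by (auto intro!: derivative_eq_intros norm_sq_has_derivative norm_sq_nz[OF assms]
        simp: fun_eq_iff power2_eq_square divide_inverse)
  have "(ccoord k has_derivative ccoord k) (at z)"
    unfolding ccoord_def[abs_def] by (cases "k = 1") (auto intro!: derivative_eq_intros)
  from has_derivative_mult[OF this inv] have "((\<lambda>z. ccoord k z * (1 + of_real m / norm_sq z)) has_derivative
     (\<lambda>u. ((if k = 1 then 1 + of_real m / norm_sq z else 0) - of_real m * ccoord k z * cnj (fst z) / (norm_sq z)\<^sup>2) * fst u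
       + ((if k = 1 then 0 else 1 + of_real m / norm_sq z) - of_real m * ccoord k z * cnj (snd z) / (norm_sq z)\<^sup>2) * snd u
       + (- of_real m * ccoord k z * fst z / (norm_sq z)\<^sup>2) * cnj (fst u)
       + (- of_real m * ccoord k z * snd z / (norm_sq z)\<^sup>2) * cnj (snd u))) (at z)"
    by (rule has_derivative_eq_rhs)
       (auto simp: fun_eq_iff ccoord_def algebra_simps add_divide_distrib diff_divide_distrib)
  from wirtinger_eqI(1)[OF this]
  have "wirtinger j (\<lambda>z. ccoord k z * (1 + of_real m / norm_sq z)) z =
    (if (j = 1) = (k = 1) then 1 + of_real m / norm_sq z else 0)
    - of_real m * ccoord k z * cnj (ccoord j z) / (norm_sq z)\<^sup>2"
    by (auto simp: ccoord_def)
  moreover have "wirtinger j (wirtinger_bar k (burns_potential m)) z =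
      wirtinger j (\<lambda>z. ccoord k z * (1 + of_real m / norm_sq z)) z"
    by (rule wirtinger_cong_open[OF o]) (auto simp: assms wirtinger_bar_burns_potential)
  ultimately show ?thesis by simp
qed

text \<open>The complex Hessian of \<open>\<parallel>z\<parallel>\<^sup>2 + m ln \<parallel>z\<parallel>\<^sup>2\<close> on the punctured plane.\<close>

definition potential_herm :: "real \<Rightarrow> C2 \<Rightarrow> C2 \<Rightarrow> C2 \<Rightarrow> complex" where
  "potential_herm m z X Y =
     (1 + of_real m / norm_sq z) * (fst X * cnj (fst Y) + snd X * cnj (snd Y))
     - of_real m / (norm_sq z)\<^sup>2 * (fst X * cnj (fst z) + snd X * cnj (snd z))
         * (fst z * cnj (fst Y) + snd z * cnj (snd Y))"

lemma i_ddbar_burns_potential: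
  assumes "z \<noteq> 0"
  shows "i_ddbar (burns_potential m) z X Y = \<i> * (potential_herm m z X Y - potential_herm m z Y X)"
  unfolding i_ddbar_def wirtinger_wirtinger_bar_burns_potential[OF assms]
  by (simp add: ccoord_def potential_herm_def algebra_simps add_divide_distrib diff_divide_distrib)

lemma blow_down_simps:
  "blow_down True x = (fst x, fst x * snd x)" "blow_down False x = (fst x * snd x, fst x)"
  by (simp_all add: blow_down_def blowup_simps)

lemma blow_down_eq_0_iff: "blow_down i x = 0 \<longleftrightarrow> fst x = 0"
  by (cases i) (auto simp: blow_down_simps prod_eq_iff)

lemma pderivative_blow_down:
  "pderivative (blow_down True) x u = (fst u, fst u * snd x + fst x * snd u)"
  "pderivative (blow_down False) x u = (fst u * snd x + fst x * snd u, fst u)"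
proof -
  have "(blow_down True has_derivative (\<lambda>u. (fst u, fst u * snd x + fst x * snd u))) (at x)"
    "(blow_down False has_derivative (\<lambda>u. (fst u * snd x + fst x * snd u, fst u))) (at x)"
    unfolding blow_down_simps[abs_def] by (auto intro!: derivative_eq_intros)
  then show "pderivative (blow_down True) x u = (fst u, fst u * snd x + fst x * snd u)"
    "pderivative (blow_down False) x u = (fst u * snd x + fst x * snd u, fst u)"
    by (auto dest: pderivativeI)
qed

lemma norm_sq_blow_down: "norm_sq (blow_down i x) = line_sq x * (fst x * cnj (fst x))"
  by (cases i) (simp_all add: blow_down_simps norm_sq_def line_sq_def algebra_simps)

text \<open>The image of \<open>X\<close> has inner product \<open>a' s p\<close> with \<open>z\<close>, where \<open>p\<close> is the vertical part of \<open>X\<close> and \<open>a'\<close> the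
  conjugate of \<open>a\<close>.  The terms \<open>m |p|\<^sup>2 / |a|\<^sup>2\<close> of the two summands therefore cancel, and no pole at
  \<open>a = 0\<close> is left.\<close>

lemma potential_herm_blow_down:
  assumes "fst x \<noteq> 0"
  shows "potential_herm m (blow_down i x) (pderivative (blow_down i) x X) (pderivative (blow_down i) x Y)
    = burns_herm m x X Y"
proof -
  define a b A B s M where ab: "a = fst x" "b = snd x" "A = cnj (fst x)" "B = cnj (snd x)"
    "s = line_sq x" "M = complex_of_real m"
  define X1 X2 Y1 Y2 where XY: "X1 = fst X" "X2 = snd X" "Y1 = cnj (fst Y)" "Y2 = cnj (snd Y)"
  have nz: "a \<noteq> 0" "A \<noteq> 0" "s \<noteq> 0" using assms by (auto simp: ab)
  have s: "s = 1 + b * B" by (simp add: ab line_sq_def)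
  define Q where "Q = X1 * Y1 + (X1 * b + a * X2) * (Y1 * B + A * Y2)"
  have *: "potential_herm m (blow_down i x) (pderivative (blow_down i) x X) (pderivative (blow_down i) x Y)
    = (1 + M / (s * (a * A))) * Q
      - M / (s * (a * A))\<^sup>2 * (X1 * A + (X1 * b + a * X2) * (A * B)) * (a * Y1 + a * b * (Y1 * B + A * Y2))"
    unfolding potential_herm_def norm_sq_blow_down
    by (cases i) (simp_all only: pderivative_blow_down blow_down_simps fst_conv snd_conv
        complex_cnj_mult complex_cnj_add Q_def ab XY mult_ac add_ac)
  have 1: "X1 * A + (X1 * b + a * X2) * (A * B) = A * (s * X1 + a * B * X2)"
    "a * Y1 + a * b * (Y1 * B + A * Y2) = a * (s * Y1 + A * b * Y2)"
    by (simp_all add: s algebra_simps)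
  have 2: "s * Q = (s * X1 + a * B * X2) * (s * Y1 + A * b * Y2) + a * A * (X2 * Y2)"
    unfolding Q_def s by algebra
  have 3: "M / (s * (a * A)) * Q = M / (s * s * (a * A)) * (s * Q)"
    "M / (s * (a * A))\<^sup>2 * (A * V) * (a * W) = M / (s * s * (a * A)) * (V * W)" for V W
    using nz by (simp_all add: power2_eq_square)
  have 4: "M / (s * s * (a * A)) * (a * A * (X2 * Y2)) = M / s\<^sup>2 * (X2 * Y2)"
    using nz by (simp add: power2_eq_square)
  have "(1 + M / (s * (a * A))) * Q - M / (s * (a * A))\<^sup>2 * (A * (s * X1 + a * B * X2)) * (a * (s * Y1 + A * b * Y2))
      = Q + M / s\<^sup>2 * (X2 * Y2)"
    unfolding distrib_right 3 2 4[symmetric] by (simp add: distrib_left)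
  moreover have "Q + M / s\<^sup>2 * (X2 * Y2) = s * (X1 * Y1) + A * b * (X1 * Y2) + a * B * (X2 * Y1) + (a * A + M / s\<^sup>2) * (X2 * Y2)"
    unfolding Q_def s by (simp add: algebra_simps)
  ultimately show ?thesis
    unfolding * 1 by (simp add: burns_herm_def ab XY)
qed

lemma dense_fst_neq_0:
  assumes "open S" "S \<noteq> {}" shows "\<exists>x\<in>S. fst (x :: C2) \<noteq> 0"
proof -
  obtain x where x: "x \<in> S" using assms by blast
  obtain e where e: "e > 0" "ball x e \<subseteq> S" using assms(1) x by (meson openE)
  (* Either x itself or this small translate of it is off the divisor. *)
  let ?y = "x + (of_real (e / 2), 0)"
  have "?y \<in> S" using e by (intro subsetD[OF e(2)]) (simp add: dist_norm norm_minus_commute norm_prod_def)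
  moreover have "fst x \<noteq> 0 \<or> fst ?y \<noteq> 0" using e by auto
  ultimately show ?thesis using x by blast
qed

lemma line_sq_transition:
  assumes "snd x \<noteq> 0"
  shows "line_sq (fst x * snd x, inverse (snd x)) = line_sq x / (snd x * cnj (snd x))"
  using assms by (simp add: line_sq_def field_simps)

lemma radial_transition:
  assumes "snd x \<noteq> 0"
  shows "radial m (fst x * snd x, inverse (snd x)) = radial m x"
  unfolding radial_def line_sq_transition[OF assms] using assms by (simp add: field_simps)

lemma vert_transition:
  assumes "snd x \<noteq> 0"
  shows "vert (fst x * snd x, inverse (snd x)) (fst u * snd x + fst x * snd u, - snd u / (snd x)\<^sup>2)
    = snd x * vert x u"
proof -
  define r where "r = inverse (line_sq x)"
  have r: "r * (1 + snd x * cnj (snd x)) = 1" using line_sq_nz[of x] by (simp add: r_def flip: line_sq_def)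
  have "vert (fst x * snd x, inverse (snd x)) (fst u * snd x + fst x * snd u, - snd u / (snd x)\<^sup>2)
    = fst u * snd x + fst x * snd u - fst x * r * snd u"
    unfolding vert_def fst_conv snd_conv line_sq_transition[OF assms] r_def
    using assms by (simp add: divide_simps power2_eq_square)
  also have "\<dots> = snd x * (fst u + fst x * cnj (snd x) * r * snd u)" using r by algebra
  finally show ?thesis by (simp add: vert_def r_def divide_inverse)
qed

text \<open>The transition map multiplies the vertical part by \<open>b\<close> and the second component by \<open>- 1 / b\<^sup>2\<close>.  It
  preserves \<open>P\<close> and divides \<open>s\<close> by \<open>|b|\<^sup>2\<close>, which makes up for both factors.\<close>

lemma burns_herm_transition:
  assumes "snd x \<noteq> 0"
  shows "burns_herm m (fst x * snd x, inverse (snd x)) (fst u * snd x + fst x * snd u, - snd u / (snd x)\<^sup>2)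
      (fst v * snd x + fst x * snd v, - snd v / (snd x)\<^sup>2) = burns_herm m x u v"
  unfolding burns_herm_adapted line_sq_transition[OF assms] radial_transition[OF assms] vert_transition[OF assms]
  using assms by (simp add: divide_simps power2_eq_square)

lemma bilin_field_burns: "bilin_field blowup (\<lambda>_. burns m)"
  unfolding bilin_field_def
proof (intro ballI allI)
  fix i j x u v assume x: "x \<in> overlap blowup i j"
  show "burns m x u v = burns m (transition blowup i j x) (dtransition blowup i j x u) (dtransition blowup i j x v)"
  proof (cases "i = j")
    case True
    then show ?thesis by (simp add: transition_blowup_self dtransition_blowup_self)
  next
    case False
    then have "snd x \<noteq> 0" using x by (simp add: overlap_blowup)
    then show ?thesis
      unfolding burns_def transition_blowup[OF False \<open>snd x \<noteq> 0\<close>] dtransition_blowup[OF False \<open>snd x \<noteq> 0\<close>]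
        burns_herm_transition[OF \<open>snd x \<noteq> 0\<close>] by simp
  qed
qed

lemma endo_field_J: "endo_field blowup blowup_J"
  unfolding endo_field_def
proof (intro ballI allI)
  fix i j x u assume x: "x \<in> overlap blowup i j"
  show "dtransition blowup i j x (blowup_J i x u) = blowup_J j (transition blowup i j x) (dtransition blowup i j x u)"
  proof (cases "i = j")
    case True
    then show ?thesis by (simp add: dtransition_blowup_self blowup_J_def J_std_def)
  next
    case False
    then have "snd x \<noteq> 0" using x by (simp add: overlap_blowup)
    then show ?thesis
      by (simp add: dtransition_blowup[OF False] blowup_J_def J_std_def cscale_def algebra_simps)
  qed
qed

lemma riemannian_metric_burns: "m > 0 \<Longrightarrow> riemannian_metric blowup (\<lambda>_. burns m)"
  by (simp add: riemannian_metric_def bilin_field_burns blowup_simps riemannian_burns)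

lemma burns_J_eq_i_ddbar:
  assumes "fst x \<noteq> 0"
  shows "complex_of_real (burns m x (J_std x X) Y) =
      i_ddbar (burns_potential m) (blow_down i x)
        (pderivative (blow_down i) x X) (pderivative (blow_down i) x Y)"
proof -
  have "i_ddbar (burns_potential m) (blow_down i x)
        (pderivative (blow_down i) x X) (pderivative (blow_down i) x Y) =
      \<i> * (burns_herm m x X Y - cnj (burns_herm m x X Y))"
    using assms by (simp add: i_ddbar_burns_potential blow_down_eq_0_iff potential_herm_blow_down cnj_burns_herm)
  also have "\<dots> = of_real (2 * Re (\<i> * burns_herm m x X Y))"
    by (simp add: complex_eq_iff)
  finally show ?thesis by (simp add: burns_def J_std_def burns_herm_scale)
qed

lemma burns_metric_burns: "m > 0 \<Longrightarrow> burns_metric m (\<lambda>_. burns m)"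
  unfolding burns_metric_def
  using riemannian_metric_burns burns_J_eq_i_ddbar by (simp add: blow_down_eq_0_iff blowup_J_def)

text \<open>Off the divisor the metric is prescribed; both candidates are continuous and the
  complement of the divisor is dense.\<close>

lemma burns_metric_unique:
  assumes m: "m > 0" and g: "burns_metric m g"
  shows "g = (\<lambda>_. burns m)"
proof (intro ext)
  fix i x u v
  have eq: "g i y u v = burns m y u v" if y: "fst y \<noteq> 0" for y
  proof -
    let ?X = "cscale (- \<i>) u"
    have "complex_of_real (g i y (blowup_J i y ?X) v) = complex_of_real (burns m y (J_std y ?X) v)"
      using g y burns_J_eq_i_ddbar[OF y, of m ?X v i] unfolding burns_metric_def blow_down_eq_0_iff
      by metis
    moreover have "J_std y ?X = u" by (simp add: J_std_def cscale_def)
    ultimately show ?thesis by (simp add: blowup_J_def)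
  qed
  have "riemannian_on UNIV (g i)"
    using g by (simp add: burns_metric_def riemannian_metric_def blowup_simps)
  then have "smooth_on UNIV (\<lambda>y. g i y u v)"
    unfolding riemannian_on_def by blast
  then have cont: "continuous_on UNIV (\<lambda>y. g i y u v - burns m y u v)"
    using smooth_burns[of UNIV m u v] by (intro continuous_on_diff smooth_on_imp_continuous_on) auto
  have "open {y. g i y u v - burns m y u v \<noteq> 0}"
    using cont by (intro open_Collect_neq continuous_on_const)
  then have "{y. g i y u v - burns m y u v \<noteq> 0} = {}"
    using dense_fst_neq_0 eq by (metis (mono_tags, lifting) diff_self mem_Collect_eq)
  then have "g i x u v - burns m x u v = 0" by blast
  then show "g i x u v = burns m x u v" by simp
qed

section \<open>Holomorphic curvature\<close>

text \<open>\<open>M v\<close> is the antilinear part of the real derivative of \<open>f\<close>.  Because the curvature of a Kaehler metric is the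
  \<open>(0, 1)\<close> derivative of its Christoffel symbols, a calculus for this part suffices.\<close>

definition has_dbar :: "(C2 \<Rightarrow> complex) \<Rightarrow> C2 \<Rightarrow> (C2 \<Rightarrow> complex) \<Rightarrow> bool" where
  "has_dbar f x M \<longleftrightarrow>
     (\<exists>D. (f has_derivative D) (at x) \<and> (\<forall>v. D v + \<i> * D (cscale \<i> v) = 2 * M v))"

lemma has_dbar_const: "has_dbar (\<lambda>_. c) x (\<lambda>_. 0)"
  unfolding has_dbar_def by (rule exI[of _ "\<lambda>_. 0"]) auto

lemma has_dbar_coords:
  "has_dbar fst x (\<lambda>_. 0)" "has_dbar snd x (\<lambda>_. 0)"
  "has_dbar (\<lambda>x. cnj (fst x)) x (\<lambda>v. cnj (fst v))" "has_dbar (\<lambda>x. cnj (snd x)) x (\<lambda>v. cnj (snd v))"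
  unfolding has_dbar_def
  by (rule exI conjI derivative_intros has_derivative_ident | force simp: cscale_def)+

lemma has_dbar_add:
  assumes "has_dbar f x M" "has_dbar g x N"
  shows "has_dbar (\<lambda>x. f x + g x) x (\<lambda>v. M v + N v)"
proof -
  obtain D E where D: "(f has_derivative D) (at x)" "\<And>v. D v + \<i> * D (cscale \<i> v) = 2 * M v"
    and E: "(g has_derivative E) (at x)" "\<And>v. E v + \<i> * E (cscale \<i> v) = 2 * N v"
    using assms unfolding has_dbar_def by blast
  have "D v + E v + \<i> * (D (cscale \<i> v) + E (cscale \<i> v)) = 2 * (M v + N v)" for v
    using D(2)[of v] E(2)[of v] by algebra
  then show ?thesis using has_derivative_add[OF D(1) E(1)] unfolding has_dbar_def by blast
qed

lemma has_dbar_mult: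
  assumes "has_dbar f x M" "has_dbar g x N"
  shows "has_dbar (\<lambda>x. f x * g x) x (\<lambda>v. f x * N v + M v * g x)"
proof -
  obtain D E where D: "(f has_derivative D) (at x)" "\<And>v. D v + \<i> * D (cscale \<i> v) = 2 * M v"
    and E: "(g has_derivative E) (at x)" "\<And>v. E v + \<i> * E (cscale \<i> v) = 2 * N v"
    using assms unfolding has_dbar_def by blast
  have "f x * E v + D v * g x + \<i> * (f x * E (cscale \<i> v) + D (cscale \<i> v) * g x)
      = 2 * (f x * N v + M v * g x)" for v
    using D(2)[of v] E(2)[of v] by algebra
  then show ?thesis using has_derivative_mult[OF D(1) E(1)] unfolding has_dbar_def by blast
qed

lemma has_dbar_inverse:
  assumes "has_dbar f x M" "f x \<noteq> 0"
  shows "has_dbar (\<lambda>x. inverse (f x)) x (\<lambda>v. - (M v * (inverse (f x))\<^sup>2))"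
proof -
  obtain D where D: "(f has_derivative D) (at x)" "\<And>v. D v + \<i> * D (cscale \<i> v) = 2 * M v"
    using assms unfolding has_dbar_def by blast
  have "- (inverse (f x) * D v * inverse (f x)) + \<i> * - (inverse (f x) * D (cscale \<i> v) * inverse (f x))
      = 2 * - (M v * (inverse (f x))\<^sup>2)" for v
    using D(2)[of v] by algebra
  then show ?thesis using Deriv.has_derivative_inverse[OF assms(2) D(1)] unfolding has_dbar_def by blast
qed

lemma has_dbar_cong:
  assumes "has_dbar f x M" "\<And>v. M v = N v"
  shows "has_dbar f x N"
  using assms by (simp add: has_dbar_def)

lemma has_dbar_line_sq: "has_dbar line_sq x (\<lambda>v. snd x * cnj (snd v))"
  unfolding line_sq_def[abs_def]
  by (rule has_dbar_cong, (rule has_dbar_add has_dbar_const has_dbar_mult has_dbar_coords)+) simp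

lemma has_dbar_radial: "has_dbar (radial m) x (\<lambda>v. line_sq x * fst x * cnj (vert x v))"
  unfolding radial_def[abs_def]
  apply (rule has_dbar_cong)
   apply (rule has_dbar_add has_dbar_const has_dbar_mult has_dbar_coords has_dbar_line_sq)+
  apply (simp add: vert_def algebra_simps)
  done

text \<open>The three coefficient functions of \<open>burns_gamma\<close>.  Expressed by the vertical part of \<open>v\<close> instead of its
  first component, their derivatives have few terms.\<close>

lemma has_dbar_coeffs:
  assumes "m > 0"
  shows "has_dbar (\<lambda>x. cnj (snd x) * inverse (line_sq x) * inverse (radial m x)) x
      (\<lambda>v. cnj (snd v) / ((line_sq x)\<^sup>2 * radial m x) - fst x * cnj (snd x) * cnj (vert x v) / (radial m x)\<^sup>2)" (is ?A)
    and "has_dbar (\<lambda>x. fst x * (cnj (snd x) * inverse (line_sq x)) * (cnj (snd x) * inverse (line_sq x) * inverse (radial m x))) x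
      (\<lambda>v. fst x * (2 * cnj (snd x) * cnj (snd v) / ((line_sq x)^3 * radial m x)
        - (cnj (snd x))\<^sup>2 * fst x * cnj (vert x v) / (line_sq x * (radial m x)\<^sup>2)))" (is ?B)
    and "has_dbar (\<lambda>x. line_sq x * cnj (fst x) * inverse (radial m x)) x
      (\<lambda>v. of_real m * line_sq x * cnj (vert x v) / (radial m x)\<^sup>2)" (is ?C)
proof -
  have bs: "has_dbar (\<lambda>x. cnj (snd x) * inverse (line_sq x)) x (\<lambda>v. cnj (snd v) / (line_sq x)\<^sup>2)"
  proof (rule has_dbar_cong)
    show "has_dbar (\<lambda>x. cnj (snd x) * inverse (line_sq x)) x
      (\<lambda>v. cnj (snd x) * (- (snd x * cnj (snd v) * (inverse (line_sq x))\<^sup>2)) + cnj (snd v) * inverse (line_sq x))"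
      by (intro has_dbar_mult has_dbar_inverse has_dbar_line_sq has_dbar_coords line_sq_nz)
    have "cnj (snd x) * (- (snd x * c * (inverse (line_sq x))\<^sup>2)) + c * inverse (line_sq x) = c / (line_sq x)\<^sup>2" for c
      using snd_cnj_snd[of x] by (simp add: divide_simps power2_eq_square) algebra
    then show "cnj (snd x) * (- (snd x * cnj (snd v) * (inverse (line_sq x))\<^sup>2)) + cnj (snd v) * inverse (line_sq x)
      = cnj (snd v) / (line_sq x)\<^sup>2" for v .
  qed
  have P: "has_dbar (\<lambda>x. inverse (radial m x)) x (\<lambda>v. - (line_sq x * fst x * cnj (vert x v) * (inverse (radial m x))\<^sup>2))"
    by (intro has_dbar_inverse has_dbar_radial radial_nz assms)
  show A: ?A
    by (rule has_dbar_cong[OF has_dbar_mult[OF bs P]])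
       (simp add: divide_simps radial_nz[OF assms] power2_eq_square)
  show ?B
    by (rule has_dbar_cong[OF has_dbar_mult[OF has_dbar_mult[OF has_dbar_coords(1) bs] A]])
       (simp add: field_simps radial_nz[OF assms] power2_eq_square power3_eq_cube)
  have sa: "has_dbar (\<lambda>x. line_sq x * cnj (fst x)) x (\<lambda>v. line_sq x * cnj (vert x v))"
    by (rule has_dbar_cong[OF has_dbar_mult[OF has_dbar_line_sq has_dbar_coords(3)]])
       (simp add: vert_def algebra_simps)
  show ?C
  proof (rule has_dbar_cong[OF has_dbar_mult[OF sa P]])
    fix v
    have "line_sq x * cnj (fst x) * (- (line_sq x * fst x * c * (inverse (radial m x))\<^sup>2)) + line_sq x * c * inverse (radial m x)
       = (radial m x - line_sq x * (fst x * cnj (fst x))) * line_sq x * c / (radial m x)\<^sup>2" for c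
      using radial_nz[OF assms, of x] by (simp add: divide_simps power2_eq_square) (simp add: algebra_simps)
    then show "line_sq x * cnj (fst x) * (- (line_sq x * fst x * cnj (vert x v) * (inverse (radial m x))\<^sup>2))
        + line_sq x * cnj (vert x v) * inverse (radial m x) = of_real m * line_sq x * cnj (vert x v) / (radial m x)\<^sup>2"
      by (simp add: radial_def)
  qed
qed

lemma burns_gamma_scale:
  "burns_gamma m x (cscale c u) v = cscale c (burns_gamma m x u v)" "burns_gamma m x u (cscale c v) = cscale c (burns_gamma m x u v)"
  by (simp_all add: burns_gamma_def cscale_def algebra_simps add_divide_distrib)

text \<open>The antilinear derivative of \<open>burns_gamma m x u u\<close> in the direction \<open>u\<close>.\<close>

definition dbar_burns_gamma :: "real \<Rightarrow> C2 \<Rightarrow> C2 \<Rightarrow> C2" where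
  "dbar_burns_gamma m x u =
    (let p = vert x u; q = snd u; b = cnj (snd x); s = line_sq x; P = radial m x in
     (2 * of_real m * q * (cnj q / (s\<^sup>2 * P) * (p + fst x * b * q / s) - fst x * b * (p * cnj p) / P\<^sup>2),
      2 * of_real m * s * q * (p * cnj p) / P\<^sup>2 - 2 * of_real m * q * (q * cnj q) / (s\<^sup>2 * P)))"

lemma has_dbar_burns_gamma:
  assumes "m > 0"
  shows "\<exists>M. has_dbar (\<lambda>x. fst (burns_gamma m x u u)) x M \<and> M u = fst (dbar_burns_gamma m x u)" (is ?A)
    and "\<exists>M. has_dbar (\<lambda>x. snd (burns_gamma m x u u)) x M \<and> M u = snd (dbar_burns_gamma m x u)" (is ?B)
proof -
  note [simp] = radial_nz[OF assms]
  have 1: "(\<lambda>x. fst (burns_gamma m x u u)) = (\<lambda>x. 2 * of_real m * fst u * snd u * (cnj (snd x) * inverse (line_sq x) * inverse (radial m x))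
    + 2 * of_real m * (snd u)\<^sup>2 * (fst x * (cnj (snd x) * inverse (line_sq x)) * (cnj (snd x) * inverse (line_sq x) * inverse (radial m x))))"
    by (simp add: burns_gamma_def fun_eq_iff divide_inverse power2_eq_square algebra_simps)
  have 2: "(\<lambda>x. snd (burns_gamma m x u u)) = (\<lambda>x. 2 * fst u * snd u * (line_sq x * cnj (fst x) * inverse (radial m x))
    + (- 2 * of_real m * (snd u)\<^sup>2) * (cnj (snd x) * inverse (line_sq x) * inverse (radial m x)))"
    by (simp add: burns_gamma_def fun_eq_iff divide_inverse power2_eq_square algebra_simps)
  have u1: "fst u = vert x u - fst x * cnj (snd x) / line_sq x * snd u" by (simp add: vert_def)
  show ?A
    unfolding 1
    apply (rule exI, rule conjI)
     apply (rule has_dbar_add has_dbar_mult[OF has_dbar_const] has_dbar_coeffs[OF assms])+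
    unfolding u1
    apply (simp add: dbar_burns_gamma_def Let_def)
    apply (simp add: divide_simps power2_eq_square power3_eq_cube)
    apply (simp add: algebra_simps)
    done
  show ?B
    unfolding 2
    apply (rule exI, rule conjI)
     apply (rule has_dbar_add has_dbar_mult[OF has_dbar_const] has_dbar_coeffs[OF assms])+
    unfolding u1
    apply (simp add: dbar_burns_gamma_def Let_def)
    apply (simp add: divide_simps power2_eq_square power3_eq_cube)
    apply (simp add: algebra_simps)
    done
qed

lemma cov_deriv_burns_const:
  "m > 0 \<Longrightarrow> cov_deriv (burns m) x u (\<lambda>_. w) = burns_gamma m x u w"
  by (simp add: cov_deriv_def christoffel_burns pderivative_def)

lemma pderivative_cscale:
  assumes "(F has_derivative D) (at x)"
  shows "pderivative (\<lambda>y. cscale c (F y)) x u = cscale c (D u)"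
proof -
  have "bounded_linear (cscale c)"
    unfolding cscale_def[abs_def]
    by (intro bounded_linear_Pair bounded_linear_mult_right[THEN bounded_linear_compose] bounded_linear_fst bounded_linear_snd)
  then show ?thesis using bounded_linear.has_derivative[OF _ assms] pderivativeI by blast
qed

text \<open>By complex bilinearity of the Christoffel symbols the quadratic terms of the curvature cancel, and
  the remaining terms \<open>- D\<^sub>u - \<i> D\<^sub>\<i>\<^sub>u\<close> select the antilinear part of the derivative.\<close>

lemma riem_curv_burns:
  assumes "m > 0"
  shows "riem_curv (burns m) x u (J_std x u) (J_std x u) = cscale (-2) (dbar_burns_gamma m x u)"
proof -
  obtain M1 D1 where D1: "((\<lambda>x. fst (burns_gamma m x u u)) has_derivative D1) (at x)"
     "\<And>v. D1 v + \<i> * D1 (cscale \<i> v) = 2 * M1 v" "M1 u = fst (dbar_burns_gamma m x u)"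
    using has_dbar_burns_gamma(1)[OF assms, of u x] unfolding has_dbar_def by blast
  obtain M2 D2 where D2: "((\<lambda>x. snd (burns_gamma m x u u)) has_derivative D2) (at x)"
     "\<And>v. D2 v + \<i> * D2 (cscale \<i> v) = 2 * M2 v" "M2 u = snd (dbar_burns_gamma m x u)"
    using has_dbar_burns_gamma(2)[OF assms, of u x] unfolding has_dbar_def by blast
  have D: "((\<lambda>x. burns_gamma m x u u) has_derivative (\<lambda>v. (D1 v, D2 v))) (at x)"
    using has_derivative_Pair[OF D1(1) D2(1)] by simp
  have "riem_curv (burns m) x u (J_std x u) (J_std x u) =
      cscale (-1) (D1 u, D2 u) - cscale \<i> (D1 (cscale \<i> u), D2 (cscale \<i> u))"
    unfolding riem_curv_def J_std_def cov_deriv_burns_const[OF assms]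
    unfolding cov_deriv_def christoffel_burns[OF assms] burns_gamma_scale
    using pderivative_cscale[OF D, of "-1" u] pderivative_cscale[OF D, of "\<i>" "cscale \<i> u"]
    by (simp add: cscale_def)
  also have "\<dots> = cscale (-2) (dbar_burns_gamma m x u)"
    using D1(2)[of u] D2(2)[of u] D1(3) D2(3) by (simp add: cscale_def algebra_simps prod_eq_iff)
  finally show ?thesis .
qed

text \<open>With \<open>w = |p|\<^sup>2\<close> and \<open>y = |q|\<^sup>2\<close> the curvature is \<open>8 m y\<^sup>2 / s\<^sup>4 - 16 m w y / (s P)\<close>; on unit vectors
  \<open>t = 2 s w\<close> and \<open>1 - t = 2 P y / s\<^sup>2\<close>, which removes \<open>s\<close>.\<close>

lemma hol_curv_burns:
  assumes "m > 0" "burns m x u u = 1" and t: "t = 2 * Re (line_sq x) * (cmod (vert x u))\<^sup>2"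
  shows "hol_curv (burns m) J_std x u = 2 * m / (Re (radial m x))\<^sup>2 * ((1 - t)\<^sup>2 - 2 * t * (1 - t))"
proof -
  define s P where sP: "s = Re (line_sq x)" "P = Re (radial m x)"
  have s: "line_sq x = of_real s" and P: "radial m x = of_real P" by (simp_all add: sP line_sq_real radial_real)
  have pos: "s > 0" "P > 0" using line_sq_pos radial_pos[OF assms(1)] by (auto simp: sP)
  define p q where pq: "p = vert x u" "q = snd u"
  define y where "y = (cmod q)\<^sup>2"
  define w where "w = (cmod p)\<^sup>2"
  have pp: "p * cnj p = of_real w" "q * cnj q = of_real y" 
    by (simp_all only: w_def y_def complex_norm_square)
  have v: "vert x (dbar_burns_gamma m x u) = 2 * of_real m * p * (q * cnj q) / ((of_real s)\<^sup>2 * of_real P)"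
    unfolding dbar_burns_gamma_def Let_def vert_def[of x "(_, _)"] fst_conv snd_conv s P pq[symmetric]
    using pos by (simp add: divide_simps) (simp add: algebra_simps power2_eq_square)
  have sn: "snd (dbar_burns_gamma m x u) = 2 * of_real m * of_real s * q * (p * cnj p) / (of_real P)\<^sup>2
      - 2 * of_real m * q * (q * cnj q) / ((of_real s)\<^sup>2 * of_real P)"
    by (simp add: dbar_burns_gamma_def Let_def s P pq)
  have "burns_herm m x (dbar_burns_gamma m x u) u = of_real (4 * m * w * y / (s * P) - 2 * m * y\<^sup>2 / s ^ 4)"
  proof -
    have "burns_herm m x (dbar_burns_gamma m x u) u =
       of_real s * (2 * of_real m * (p * cnj p) * (q * cnj q) / ((of_real s)\<^sup>2 * of_real P))
       + of_real P / (of_real s)\<^sup>2 * (2 * of_real m * of_real s * (q * cnj q) * (p * cnj p) / (of_real P)\<^sup>2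
      - 2 * of_real m * (q * cnj q) * (q * cnj q) / ((of_real s)\<^sup>2 * of_real P))"
      unfolding burns_herm_adapted v sn unfolding s P pq[symmetric] by (simp add: algebra_simps)
    also have "\<dots> = of_real (s * (2 * m * w * y / (s\<^sup>2 * P))
       + P / s\<^sup>2 * (2 * m * s * y * w / P\<^sup>2 - 2 * m * y * y / (s\<^sup>2 * P)))"
      unfolding pp by simp
    also have "s * (2 * m * w * y / (s\<^sup>2 * P))
       + P / s\<^sup>2 * (2 * m * s * y * w / P\<^sup>2 - 2 * m * y * y / (s\<^sup>2 * P)) = 4 * m * w * y / (s * P) - 2 * m * y\<^sup>2 / s ^ 4"
      using pos by (simp add: divide_simps power2_eq_square power4_eq_xxxx)
    finally show ?thesis .
  qed
  then have h: "hol_curv (burns m) J_std x u = - 4 * (4 * m * w * y / (s * P) - 2 * m * y\<^sup>2 / s ^ 4)"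
    by (simp add: hol_curv_def riem_curv_burns[OF assms(1)] burns_def burns_herm_scale)
  have t': "t = 2 * s * w" by (simp add: t sP w_def pq)
  have "1 = 2 * (s * w + P / s\<^sup>2 * y)" using assms(2) unfolding burns_self sP[symmetric] w_def y_def pq by simp
  then have y: "1 - t = 2 * P / s\<^sup>2 * y" by (simp add: t')
  show ?thesis unfolding h sP[symmetric] y unfolding t'
    using pos by (simp add: divide_simps power2_eq_square power4_eq_xxxx) (simp add: algebra_simps)
qed

section \<open>The opposite Hermitian structure\<close>

definition vertical :: "C2 set" where
  "vertical = {v. snd v = 0}"

text \<open>Multiplication by \<open>\<i>\<close> on the vertical part and by \<open>-\<i>\<close> on its complement.\<close>

definition opposite :: "C2 endo" where
  "opposite x u = (\<i> * (2 * vert x u - fst u), - \<i> * snd u)"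

text \<open>The vector with prescribed vertical part and second component.\<close>

definition frame :: "C2 \<Rightarrow> complex \<Rightarrow> complex \<Rightarrow> C2" where
  "frame x p q = (p - fst x * cnj (snd x) / line_sq x * q, q)"

lemma frame_simps [simp]: "vert x (frame x p q) = p" "snd (frame x p q) = q"
  by (simp_all add: vert_def frame_def)

lemma adapted_eqI: "vert x u = vert x v \<Longrightarrow> snd u = snd v \<Longrightarrow> u = v"
  by (simp add: vert_def prod_eq_iff)

lemma linear_vert: "linear (vert x)"
  by (rule linearI) (simp_all add: vert_def algebra_simps add_divide_distrib scaleR_conv_of_real)

lemmas vert_linear_simps [simp] = linear_add[OF linear_vert] linear_diff[OF linear_vert]
  linear_neg[OF linear_vert] linear_0[OF linear_vert]

lemma vert_vertical [simp]: "vert x (c, 0) = c"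
  by (simp add: vert_def)

lemma burns_adapted:
  "burns m x v w = 2 * (Re (line_sq x) * Re (vert x v * cnj (vert x w))
     + Re (radial m x) / (Re (line_sq x))\<^sup>2 * Re (snd v * cnj (snd w)))"
proof -
  obtain s P where s: "line_sq x = of_real s" "radial m x = of_real P" by (metis line_sq_real radial_real)
  have "burns_herm m x v w = of_real s * (vert x v * cnj (vert x w)) + of_real (P / s\<^sup>2) * (snd v * cnj (snd w))"
    unfolding burns_herm_adapted s by simp
  then show ?thesis unfolding burns_def s
    by (simp del: of_real_divide)
qed

lemma vert_opposite [simp]: "vert x (opposite x u) = \<i> * vert x u"
  by (simp add: vert_def opposite_def algebra_simps)

lemma snd_opposite [simp]: "snd (opposite x u) = - \<i> * snd u"
  by (simp add: opposite_def)

lemma opposite_opposite: "opposite x (opposite x u) = - u"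
  by (rule adapted_eqI[of x]) simp_all

lemma orth_compl_vertical: "orth_compl (burns m x) vertical = {v. vert x v = 0}"
proof (intro equalityI subsetI)
  fix v assume "v \<in> orth_compl (burns m x) vertical"
  then have "burns m x v (vert x v, 0) = 0" by (auto simp: orth_compl_def vertical_def)
  then have "Re (line_sq x) * Re (vert x v * cnj (vert x v)) = 0" by (simp add: burns_adapted)
  then have "Re (vert x v * cnj (vert x v)) = 0" using line_sq_pos[of x] by simp
  then show "v \<in> {v. vert x v = 0}"
    by (simp add: complex_eq_iff sum_power2_eq_zero_iff flip: power2_eq_square)
next
  fix v assume "v \<in> {v. vert x v = 0}"
  then show "v \<in> orth_compl (burns m x) vertical"
    by (auto simp: orth_compl_def vertical_def burns_adapted)
qed

lemma orth_proj_vertical: "orth_proj (burns m x) vertical u = (vert x u, 0)"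
  unfolding orth_proj_def orth_compl_vertical
proof (rule the_equality)
  fix p assume p: "p \<in> vertical \<and> u - p \<in> {v. vert x v = 0}"
  then have "p = (fst p, 0)" by (simp add: vertical_def prod_eq_iff)
  then show "p = (vert x u, 0)" using p by (metis (mono_tags, lifting) mem_Collect_eq right_minus_eq
      vert_linear_simps(2) vert_vertical)
qed (simp add: vertical_def)

lemma opposite_structure_burns: "opposite_structure (burns m) J_std (\<lambda>_. vertical) = opposite"
  by (intro ext) (simp add: opposite_structure_def orth_proj_vertical J_std_def cscale_def opposite_def algebra_simps)

lemma smooth_opposite: "open S \<Longrightarrow> smooth_on S (\<lambda>x. opposite x u)"
  unfolding opposite_def vert_def by (intro smooth_intros) auto

lemma almost_complex_opposite:
  assumes "open S" shows "almost_complex_on S opposite"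
proof -
  have "linear (opposite x)" for x
    by (rule linearI) (simp_all add: opposite_def linear_cmul[OF linear_vert] algebra_simps scaleR_conv_of_real)
  then show ?thesis using smooth_opposite[OF assms] opposite_opposite by (simp add: almost_complex_on_def)
qed

lemma burns_opposite: "burns m x (opposite x u) (opposite x v) = burns m x u v"
  by (simp add: burns_adapted)

text \<open>The derivative of the coefficient \<open>a b' / s\<close> by which the horizontal planes are tilted.\<close>

definition deriv_shear :: "C2 \<Rightarrow> C2 \<Rightarrow> complex" where
  "deriv_shear x u = cnj (snd x) / line_sq x * fst u + fst x / (line_sq x)\<^sup>2 * cnj (snd u)
     - fst x * (cnj (snd x))\<^sup>2 / (line_sq x)\<^sup>2 * snd u"

lemma deriv_shear_has_derivative:
  "((\<lambda>y. fst y * cnj (snd y) / line_sq y) has_derivative deriv_shear x) (at x)"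
proof (rule has_derivative_eq_rhs)
  show "((\<lambda>y. fst y * cnj (snd y) / line_sq y) has_derivative
    (\<lambda>u. ((fst x * cnj (snd u) + fst u * cnj (snd x)) * line_sq x
      - fst x * cnj (snd x) * (snd u * cnj (snd x) + snd x * cnj (snd u))) / (line_sq x * line_sq x))) (at x)"
    by (intro has_derivative_divide' line_sq_has_derivative derivative_intros line_sq_nz)
  have "((fst x * c2 + u1 * cnj (snd x)) * line_sq x
      - fst x * cnj (snd x) * (u2 * cnj (snd x) + snd x * c2)) / (line_sq x * line_sq x) =
      cnj (snd x) / line_sq x * u1 + fst x / (line_sq x)\<^sup>2 * c2 - fst x * (cnj (snd x))\<^sup>2 / (line_sq x)\<^sup>2 * u2" for u1 u2 c2
    using snd_cnj_snd[of x] by (simp add: divide_simps power2_eq_square) algebra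
  then show "(\<lambda>u. ((fst x * cnj (snd u) + fst u * cnj (snd x)) * line_sq x
      - fst x * cnj (snd x) * (snd u * cnj (snd x) + snd x * cnj (snd u))) / (line_sq x * line_sq x)) = deriv_shear x"
    by (simp add: fun_eq_iff deriv_shear_def)
qed

lemma vert_has_derivative: "((\<lambda>y. vert y v) has_derivative (\<lambda>u. deriv_shear x u * snd v)) (at x)"
  unfolding vert_def
  using has_derivative_add[OF has_derivative_const has_derivative_mult_left[OF deriv_shear_has_derivative]] by simp

lemma pderivative_opposite: "pderivative (\<lambda>y. opposite y v) x u = (2 * \<i> * deriv_shear x u * snd v, 0)"
proof -
  have "((\<lambda>y. opposite y v) has_derivative (\<lambda>u. (2 * \<i> * deriv_shear x u * snd v, 0))) (at x)"
    unfolding opposite_def by (auto intro!: derivative_eq_intros vert_has_derivative)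
  then show ?thesis by (rule pderivativeI)
qed

text \<open>\<open>deriv_shear x\<close> fails to be complex linear for \<open>I\<close> only by a multiple of \<open>snd u\<close>; as only its product
  with \<open>snd v\<close>, antisymmetrised, enters the torsion, \<open>I\<close> is integrable.\<close>

lemma deriv_shear_opposite: "deriv_shear x (opposite x u) = \<i> * deriv_shear x u + 4 * \<i> * fst x * (cnj (snd x))\<^sup>2 / (line_sq x)\<^sup>2 * snd u"
  by (simp add: deriv_shear_def opposite_def vert_def divide_simps power2_eq_square) (simp add: algebra_simps)

lemma opposite_vertical: "opposite x (c, 0) = (\<i> * c, 0)"
  by (rule adapted_eqI[of x]) simp_all

lemma nijenhuis_opposite: "nijenhuis opposite x u v = 0"
proof -
  have c: "pderivative (\<lambda>y. w) x z = 0" for w z :: C2 by (simp add: pderivative_def)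
  have m: "- (a, b) = (- a, - b)" for a b :: complex by simp
  have "nijenhuis opposite x u v =
     (2 * \<i> * deriv_shear x (opposite x u) * snd v - 2 * \<i> * deriv_shear x (opposite x v) * snd u
        + \<i> * (2 * \<i> * deriv_shear x v * snd u) - \<i> * (2 * \<i> * deriv_shear x u * snd v), 0)"
    unfolding nijenhuis_def lie_bracket_def pderivative_opposite c
    by (simp add: opposite_vertical prod_eq_iff)
  also have "\<dots> = 0" unfolding deriv_shear_opposite by (simp add: algebra_simps zero_prod_def)
  finally show ?thesis .
qed

lemma hermitian_opposite:
  assumes "m > 0" "open S" shows "hermitian_on S (burns m) opposite"
  unfolding hermitian_on_def
  using riemannian_burns[OF assms] almost_complex_opposite[OF assms(2)] burns_opposite nijenhuis_opposite by blast

lemma vert_burns_gamma: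
  assumes "m > 0"
  shows "vert x (burns_gamma m x u v) = (fst u * snd v + snd u * fst v) * (cnj (snd x) / line_sq x)"
proof -
  have "of_real m * cnj (snd x) / (line_sq x * radial m x) + fst x * cnj (snd x) / line_sq x * (line_sq x * cnj (fst x) / radial m x)
     = (line_sq x * (fst x * cnj (fst x)) + of_real m) * (cnj (snd x) / (line_sq x * radial m x))"
    using radial_nz[OF assms, of x] by (simp add: divide_simps) (simp add: algebra_simps)
  also have "\<dots> = cnj (snd x) / line_sq x"
    using radial_nz[OF assms, of x] by (simp flip: radial_def)
  finally have 1: "of_real m * cnj (snd x) / (line_sq x * radial m x) + fst x * cnj (snd x) / line_sq x * (line_sq x * cnj (fst x) / radial m x)
     = cnj (snd x) / line_sq x" .
  have 2: "2 * of_real m * fst x * (cnj (snd x))\<^sup>2 / ((line_sq x)\<^sup>2 * radial m x)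
     - fst x * cnj (snd x) / line_sq x * (2 * of_real m * cnj (snd x) / (line_sq x * radial m x)) = 0"
    by (simp add: power2_eq_square)
  have "vert x (burns_gamma m x u v) = (fst u * snd v + snd u * fst v) *
      (of_real m * cnj (snd x) / (line_sq x * radial m x) + fst x * cnj (snd x) / line_sq x * (line_sq x * cnj (fst x) / radial m x))
    + snd u * snd v * (2 * of_real m * fst x * (cnj (snd x))\<^sup>2 / ((line_sq x)\<^sup>2 * radial m x)
     - fst x * cnj (snd x) / line_sq x * (2 * of_real m * cnj (snd x) / (line_sq x * radial m x)))"
    unfolding vert_def burns_gamma_def fst_conv snd_conv by algebra
  then show ?thesis unfolding 1 2 by simp
qed

text \<open>\<open>\<nabla>\<^sub>u I\<close> anticommutes with \<open>I\<close> and interchanges the two planes.  Its part from the vertical to the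
  horizontal plane measures how the vertical planes turn in the direction \<open>u\<close>; the other part is
  determined by skew-symmetry.\<close>

lemma cov_deriv_opposite:
  assumes "m > 0"
  shows "cov_deriv_endo (burns m) opposite x u v =
    frame x (2 * \<i> * (fst x / (line_sq x)\<^sup>2) * cnj (snd u) * snd v)
      (2 * \<i> * (line_sq x * cnj (fst x) / radial m x) * snd u * vert x v)"
proof -
  have eq: "cov_deriv_endo (burns m) opposite x u v =
      (2 * \<i> * deriv_shear x u * snd v, 0) + burns_gamma m x u (opposite x v) - opposite x (burns_gamma m x u v)"
    unfolding cov_deriv_endo_def cov_deriv_burns_const[OF assms]
    by (simp add: cov_deriv_def pderivative_opposite christoffel_burns[OF assms])
  show ?thesis unfolding eq
  proof (rule adapted_eqI[of x])
    have "snd (burns_gamma m x u (opposite x v)) - snd (opposite x (burns_gamma m x u v)) =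
       2 * \<i> * (line_sq x * cnj (fst x) / radial m x) * snd u * vert x v"
      by (simp add: burns_gamma_def opposite_def vert_def algebra_simps add_divide_distrib)
    then show "snd ((2 * \<i> * deriv_shear x u * snd v, 0) + burns_gamma m x u (opposite x v) - opposite x (burns_gamma m x u v)) =
      snd (frame x (2 * \<i> * (fst x / (line_sq x)\<^sup>2) * cnj (snd u) * snd v)
        (2 * \<i> * (line_sq x * cnj (fst x) / radial m x) * snd u * vert x v))" by simp
    have "2 * \<i> * deriv_shear x u * snd v + vert x (burns_gamma m x u (opposite x v)) - vert x (opposite x (burns_gamma m x u v)) =
       2 * \<i> * (fst x / (line_sq x)\<^sup>2) * cnj (snd u) * snd v"
      unfolding vert_opposite vert_burns_gamma[OF assms]
      by (simp add: deriv_shear_def opposite_def vert_def power2_eq_square) (simp add: algebra_simps add_divide_distrib diff_divide_distrib)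
    then show "vert x ((2 * \<i> * deriv_shear x u * snd v, 0) + burns_gamma m x u (opposite x v) - opposite x (burns_gamma m x u v)) =
      vert x (frame x (2 * \<i> * (fst x / (line_sq x)\<^sup>2) * cnj (snd u) * snd v)
        (2 * \<i> * (line_sq x * cnj (fst x) / radial m x) * snd u * vert x v))" by simp
  qed
qed

lemma parallel_directions:
  assumes "m > 0" "fst x \<noteq> 0"
  shows "{u. \<forall>v. cov_deriv_endo (burns m) opposite x u v = 0} = vertical"
proof (intro equalityI subsetI)
  fix u assume "u \<in> {u. \<forall>v. cov_deriv_endo (burns m) opposite x u v = 0}"
  then have "snd (cov_deriv_endo (burns m) opposite x u (1, 0)) = 0" by simp
  then show "u \<in> vertical"
    using assms radial_nz[OF assms(1), of x] by (simp add: cov_deriv_opposite vertical_def)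
qed (auto simp: vertical_def cov_deriv_opposite[OF assms(1)] frame_def zero_prod_def)

lemma span_orthonormal_basis:
  fixes h :: "'e::euclidean_space \<Rightarrow> 'e \<Rightarrow> real"
  assumes h: "\<And>v. linear (h v)" and B: "orthonormal_basis h B"
  shows "span B = UNIV"
proof -
  have card: "card B = DIM('e)" and on: "\<And>b c. b \<in> B \<Longrightarrow> c \<in> B \<Longrightarrow> h b c = (if b = c then 1 else 0)"
    using B by (auto simp: orthonormal_basis_def)
  have fin: "finite B" using card by (metis DIM_positive card.infinite less_irrefl)
  have "independent B"
    unfolding independent_explicit_finite_subsets[of B]
  proof (intro allI impI ballI)
    fix S u b assume S: "S \<subseteq> B" "finite S" "(\<Sum>v\<in>S. u v *\<^sub>R v) = 0" and b: "b \<in> S"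
    have "0 = h b (\<Sum>v\<in>S. u v *\<^sub>R v)" using S(3) linear_0[OF h] by simp
    also have "\<dots> = (\<Sum>v\<in>S. u v * h b v)"
      by (simp add: linear_sum[OF h] linear_cmul[OF h])
    also have "\<dots> = (\<Sum>v\<in>S. if b = v then u v else 0)"
      using S(1) b by (intro sum.cong) (auto simp: on subset_iff)
    also have "\<dots> = u b" using S(2) b by simp
    finally show "u b = 0" by simp
  qed
  then show ?thesis using card_ge_dim_independent[of B UNIV] card by auto
qed

text \<open>\<open>norm_cov_deriv_endo\<close> selects an orthonormal basis by choice, so one must be known to exist; rescaling the
  two complex directions of the adapted decomposition gives one.\<close>

lemma ex_orthonormal_basis_burns:
  assumes "m > 0" shows "\<exists>B. orthonormal_basis (burns m x) B"
proof -
  define s P where sP: "s = Re (line_sq x)" "P = Re (radial m x)"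
  have pos: "s > 0" "P > 0" using line_sq_pos radial_pos[OF assms] by (auto simp: sP)
  (* The lengths that normalise 2 s |p|^2 and 2 (P / s^2) |q|^2 to 1. *)
  define p q where pq: "p = 1 / sqrt (2 * s)" "q = s / sqrt (2 * P)"
  have p: "2 * s * (p * p) = 1" "p \<noteq> 0" using pos by (auto simp: pq divide_simps)
  have q: "2 * P / s\<^sup>2 * (q * q) = 1" "q \<noteq> 0" using pos by (auto simp: pq divide_simps power2_eq_square)
  have b: "burns m x (frame x a b) (frame x c d) = 2 * (s * Re (a * cnj c) + P / s\<^sup>2 * Re (b * cnj d))" for a b c d
    by (simp add: burns_adapted sP)
  have f: "frame x a b = frame x c d \<longleftrightarrow> a = c \<and> b = d" for a b c d
    by (metis frame_simps)
  have i: "complex_of_real p \<noteq> \<i> * complex_of_real p" "complex_of_real q \<noteq> \<i> * complex_of_real q"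
    using p(2) q(2) by (auto simp: complex_eq_iff)
  let ?B = "{frame x (of_real p) 0, frame x (\<i> * of_real p) 0, frame x 0 (of_real q), frame x 0 (\<i> * of_real q)}"
  have "card ?B = DIM(C2)" using p(2) q(2) i by (simp add: f)
  moreover have "\<forall>b\<in>?B. \<forall>c\<in>?B. burns m x b c = (if b = c then 1 else 0)"
    using p q i pos by (simp add: b f algebra_simps)
  ultimately show ?thesis unfolding orthonormal_basis_def by blast
qed

text \<open>Off the divisor \<open>\<nabla>\<^sub>u I\<close> applied to \<open>v\<close> is nonzero as soon as \<open>snd u\<close> and the vertical part of \<open>v\<close> are nonzero, and a spanning
  set contains such vectors \<open>u\<close> and \<open>v\<close>.\<close>

lemma norm_cov_deriv_opposite_pos:
  assumes "m > 0" "fst x \<noteq> 0"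
  shows "norm_cov_deriv_endo (burns m) opposite x > 0"
proof -
  define B where "B = (SOME B. orthonormal_basis (burns m x) B)"
  have B: "orthonormal_basis (burns m x) B"
    unfolding B_def using ex_orthonormal_basis_burns[OF assms(1)] by (rule someI_ex)
  have fin: "finite B" using B unfolding orthonormal_basis_def by (metis DIM_positive card.infinite less_irrefl)
  have span: "span B = UNIV" by (rule span_orthonormal_basis[OF linear_burns B])
  have sub: "subspace {v. f v = 0}" if "linear f" for f :: "C2 \<Rightarrow> complex"
    using that by (auto simp: subspace_def linear_add linear_cmul linear_0)
  have "\<exists>b\<in>B. snd b \<noteq> 0"
  proof (rule ccontr)
    assume "\<not> ?thesis"
    then have "span B \<subseteq> {v. snd v = 0}" by (intro span_minimal sub linear_snd) auto
    then have "(0, 1) \<in> {v :: C2. snd v = 0}" unfolding span by blast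
    then show False by simp
  qed
  then obtain b where b: "b \<in> B" "snd b \<noteq> 0" by blast
  have "\<exists>c\<in>B. vert x c \<noteq> 0"
  proof (rule ccontr)
    assume "\<not> ?thesis"
    then have "span B \<subseteq> {v. vert x v = 0}" by (intro span_minimal sub linear_vert) auto
    then have "(1, 0) \<in> {v. vert x v = 0}" unfolding span by blast
    then show False by simp
  qed
  then obtain c where c: "c \<in> B" "vert x c \<noteq> 0" by blast
  let ?F = "\<lambda>b c. burns m x (cov_deriv_endo (burns m) opposite x b c) (cov_deriv_endo (burns m) opposite x b c)"
  have nn: "?F b c \<ge> 0" for b c
    using burns_pos[OF assms(1), of "cov_deriv_endo (burns m) opposite x b c" x]
    by (cases "cov_deriv_endo (burns m) opposite x b c = 0") (auto simp: burns_adapted)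
  have "snd (cov_deriv_endo (burns m) opposite x b c) \<noteq> 0"
    using assms b c radial_nz[OF assms(1), of x] by (simp add: cov_deriv_opposite)
  then have "cov_deriv_endo (burns m) opposite x b c \<noteq> 0" by auto
  then have "0 < ?F b c" by (rule burns_pos[OF assms(1)])
  also have "\<dots> \<le> (\<Sum>c\<in>B. ?F b c)" using fin c nn by (intro member_le_sum) auto
  also have "\<dots> \<le> (\<Sum>b\<in>B. \<Sum>c\<in>B. ?F b c)"
    using fin b nn by (intro member_le_sum[of b B "\<lambda>b. \<Sum>c\<in>B. ?F b c"] sum_nonneg) auto
  finally show ?thesis unfolding norm_cov_deriv_endo_def B_def[symmetric] Let_def by simp
qed

section \<open>The Lee form\<close>

text \<open>\<open>d ln P\<close>.\<close>

definition lee :: "real \<Rightarrow> C2 \<Rightarrow> C2 \<Rightarrow> real" where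
  "lee m x u = 2 * Re (line_sq x) * Re (cnj (fst x) * vert x u) / Re (radial m x)"

lemma linear_lee: "linear (lee m x)"
  by (rule linearI) (simp_all add: lee_def linear_cmul[OF linear_vert] algebra_simps add_divide_distrib)

text \<open>An alternating real 3-form on the complex line vanishes.\<close>

lemma three_form_zero:
  "Re (k * p) * Re (\<i> * q * cnj r) - Re (k * q) * Re (\<i> * p * cnj r) + Re (k * r) * Re (\<i> * p * cnj q) = 0"
  by (simp add: algebra_simps)

lemma kform_opposite:
  "kform (burns m) opposite x v w = 2 * Re (line_sq x) * Re (\<i> * vert x v * cnj (vert x w))
     - 2 * (Re (radial m x) / (Re (line_sq x))\<^sup>2) * Re (\<i> * snd v * cnj (snd w))"
  by (simp add: kform_def burns_adapted algebra_simps diff_divide_distrib)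

text \<open>Written as the closed form \<open>\<omega>\<close> minus twice its horizontal part, so that only the coefficient
  \<open>P / s\<^sup>2\<close> has to be differentiated.\<close>

lemma kform_opposite_J:
  "kform (burns m) opposite x v w = burns m x (cscale \<i> v) w
     - 4 * (Re (radial m x) / (Re (line_sq x))\<^sup>2) * Re (\<i> * snd v * cnj (snd w))"
proof -
  have "vert x (cscale \<i> v) = \<i> * vert x v" "snd (cscale \<i> v) = \<i> * snd v"
    by (simp_all add: vert_def cscale_def algebra_simps)
  then show ?thesis by (simp add: kform_opposite burns_adapted algebra_simps diff_divide_distrib)
qed

lemma Re_radial_has_derivative:
  "((\<lambda>y. Re (radial m y)) has_derivative (\<lambda>u. 2 * Re (line_sq x) * Re (cnj (fst x) * vert x u))) (at x)"
proof -
  have "line_sq x * (cnj (fst x) * z + fst x * cnj z) = of_real (2 * Re (line_sq x) * Re (cnj (fst x) * z))" for z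
    by (simp add: line_sq_real complex_eq_iff algebra_simps)
  then show ?thesis using has_derivative_Re[OF radial_has_derivative[of m x]] by simp
qed

lemma Re_line_sq_has_derivative:
  "((\<lambda>y. Re (line_sq y)) has_derivative (\<lambda>u. 2 * Re (cnj (snd x) * snd u))) (at x)"
  using has_derivative_Re[OF line_sq_has_derivative[of x]] by (simp add: algebra_simps)

lemma kform_opposite_has_derivative:
  "((\<lambda>y. kform (burns m) opposite y v w) has_derivative
     (\<lambda>u. 2 * Re (del_herm m x u (cscale \<i> v) w + del_herm m x u w (cscale \<i> v))
       - 4 * (2 * Re (cnj (fst x) * vert x u) / Re (line_sq x)
              - 4 * Re (radial m x) / (Re (line_sq x)) ^ 3 * Re (cnj (snd x) * snd u)) * Re (\<i> * snd v * cnj (snd w)))) (at x)"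
proof -
  define c where "c = Re (\<i> * snd v * cnj (snd w))"
  have nz: "Re (line_sq x) \<noteq> 0" using line_sq_pos[of x] by simp
  have "((\<lambda>y. Re (radial m y) / (Re (line_sq y))\<^sup>2) has_derivative
    (\<lambda>u. 2 * Re (cnj (fst x) * vert x u) / Re (line_sq x)
              - 4 * Re (radial m x) / (Re (line_sq x)) ^ 3 * Re (cnj (snd x) * snd u))) (at x)"
  proof (rule has_derivative_eq_rhs)
    have "((\<lambda>y. Re (line_sq y) * Re (line_sq y)) has_derivative (\<lambda>u. Re (line_sq x) * (2 * Re (cnj (snd x) * snd u))
        + 2 * Re (cnj (snd x) * snd u) * Re (line_sq x))) (at x)"
      by (rule has_derivative_mult[OF Re_line_sq_has_derivative Re_line_sq_has_derivative])
    then show "((\<lambda>y. Re (radial m y) / (Re (line_sq y))\<^sup>2) has_derivative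
      (\<lambda>u. (2 * Re (line_sq x) * Re (cnj (fst x) * vert x u) * (Re (line_sq x) * Re (line_sq x))
        - Re (radial m x) * (Re (line_sq x) * (2 * Re (cnj (snd x) * snd u))
        + 2 * Re (cnj (snd x) * snd u) * Re (line_sq x))) / (Re (line_sq x) * Re (line_sq x) * (Re (line_sq x) * Re (line_sq x))))) (at x)"
      unfolding power2_eq_square using nz by (intro has_derivative_divide' Re_radial_has_derivative) auto
    have "(2 * s * l * (s * s) - P * (s * (2 * k) + 2 * k * s)) / (s * s * (s * s)) = 2 * l / s - 4 * P / s ^ 3 * k"
      if "s \<noteq> 0" for s l P k :: real
      using that by (simp add: divide_simps power3_eq_cube) (simp add: algebra_simps)
    then show "(\<lambda>u. (2 * Re (line_sq x) * Re (cnj (fst x) * vert x u) * (Re (line_sq x) * Re (line_sq x))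
        - Re (radial m x) * (Re (line_sq x) * (2 * Re (cnj (snd x) * snd u))
        + 2 * Re (cnj (snd x) * snd u) * Re (line_sq x))) / (Re (line_sq x) * Re (line_sq x) * (Re (line_sq x) * Re (line_sq x))))
      = (\<lambda>u. 2 * Re (cnj (fst x) * vert x u) / Re (line_sq x)
              - 4 * Re (radial m x) / (Re (line_sq x)) ^ 3 * Re (cnj (snd x) * snd u))"
      using nz by (intro ext) blast
  qed
  then show ?thesis unfolding kform_opposite_J c_def[symmetric]
    by (intro has_derivative_diff burns_has_derivative has_derivative_mult_left has_derivative_mult_right)
qed

text \<open>The differential of \<open>P / s\<^sup>2\<close> contributes through that of \<open>P\<close> only, since the differential of \<open>s\<close> is
  horizontal; and \<open>\<theta> \<and> \<omega>\<^sub>I\<close> only sees the horizontal part of \<open>\<omega>\<^sub>I\<close>, since \<open>\<theta>\<close> is vertical.\<close>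

lemma ext_deriv_kform_opposite:
  assumes "m > 0"
  shows "ext_deriv2 (kform (burns m) opposite) x u v w = 2 * wedge12 (lee m x) (kform (burns m) opposite x) u v w"
proof -
  define s P where sP: "s = Re (line_sq x)" "P = Re (radial m x)"
  have pos: "s > 0" "P > 0" using line_sq_pos radial_pos[OF assms] by (auto simp: sP)
  define c where "c = (\<lambda>p q. Re (\<i> * p * cnj q))"
  define L where "L = (\<lambda>u. Re (cnj (fst x) * vert x u))"
  define M where "M = (\<lambda>u :: C2. Re (cnj (snd x) * snd u))"
  have "ext_deriv2 (kform (burns m) J_std) x u v w = 0"
    using kahler_burns[OF assms, of UNIV] unfolding kahler_on_def by blast
  then have J: "2 * Re (del_herm m x u (cscale \<i> v) w + del_herm m x u w (cscale \<i> v))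
      - 2 * Re (del_herm m x v (cscale \<i> u) w + del_herm m x v w (cscale \<i> u))
      + 2 * Re (del_herm m x w (cscale \<i> u) v + del_herm m x w v (cscale \<i> u)) = 0"
    by (simp add: ext_deriv2_def kform_def J_std_def pderivative_burns)
  have "ext_deriv2 (kform (burns m) opposite) x u v w =
     - 8 / s * (L u * c (snd v) (snd w) - L v * c (snd u) (snd w) + L w * c (snd u) (snd v))
     + 16 * P / s ^ 3 * (M u * c (snd v) (snd w) - M v * c (snd u) (snd w) + M w * c (snd u) (snd v))"
    unfolding ext_deriv2_def pderivativeI[OF kform_opposite_has_derivative]
    unfolding sP[symmetric] c_def[symmetric, THEN fun_cong, THEN fun_cong] L_def[symmetric, THEN fun_cong] M_def[symmetric, THEN fun_cong]
    using J by (simp add: algebra_simps)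
  also have "M u * c (snd v) (snd w) - M v * c (snd u) (snd w) + M w * c (snd u) (snd v) = 0"
    unfolding M_def c_def by (rule three_form_zero)
  finally have 1: "ext_deriv2 (kform (burns m) opposite) x u v w =
     - 8 / s * (L u * c (snd v) (snd w) - L v * c (snd u) (snd w) + L w * c (snd u) (snd v))" by simp
  have k: "kform (burns m) opposite x v w = 2 * s * c (vert x v) (vert x w) - 2 * (P / s\<^sup>2) * c (snd v) (snd w)" for v w
    by (simp only: kform_opposite sP c_def)
  have l: "lee m x u = 2 * s / P * L u" for u by (simp add: lee_def sP L_def)
  have "wedge12 (lee m x) (kform (burns m) opposite x) u v w =
     4 * s\<^sup>2 / P * (L u * c (vert x v) (vert x w) - L v * c (vert x u) (vert x w) + L w * c (vert x u) (vert x v))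
     - 4 / s * (L u * c (snd v) (snd w) - L v * c (snd u) (snd w) + L w * c (snd u) (snd v))"
    unfolding wedge12_def k l using pos by (simp add: divide_simps power2_eq_square) (simp add: algebra_simps)
  also have "L u * c (vert x v) (vert x w) - L v * c (vert x u) (vert x w) + L w * c (vert x u) (vert x v) = 0"
    unfolding L_def c_def by (rule three_form_zero)
  finally show ?thesis using 1 by simp
qed

text \<open>A vector in one of the two orthogonal planes is tested by wedging against a basis of the
  other plane.\<close>

lemma wedge_kform_opposite_injective:
  assumes "m > 0" and d: "linear d" "\<And>u v w. wedge12 d (kform (burns m) opposite x) u v w = 0"
  shows "d u = 0"
proof -
  define s P where sP: "s = Re (line_sq x)" "P = Re (radial m x)"
  have pos: "s > 0" "P > 0" using line_sq_pos radial_pos[OF assms(1)] by (auto simp: sP)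
  (* The vector frame x 0 \<i> is minus the image of frame x 0 1 under I, so these two span the
     horizontal plane. *)
  have 1: "d (c, 0) = 0" for c
    using d(2)[of "(c, 0)" "frame x 0 1" "frame x 0 \<i>"] pos
    by (simp add: wedge12_def kform_opposite flip: sP)
  have 2: "d (frame x 0 q) = 0" for q
    using d(2)[of "frame x 0 q" "(1, 0)" "(\<i>, 0)"] pos
    by (simp add: wedge12_def kform_opposite flip: sP)
  have "u = (vert x u, 0) + frame x 0 (snd u)" by (rule adapted_eqI[of x]) simp_all
  then show ?thesis using linear_add[OF d(1)] 1 2 by (metis add_0)
qed

lemma lee_form_burns:
  assumes "m > 0" shows "lee_form (burns m) opposite x = lee m x"
  unfolding lee_form_def
proof (rule the_equality)
  show "linear (lee m x) \<and> (\<forall>u v w. ext_deriv2 (kform (burns m) opposite) x u v w = 2 * wedge12 (lee m x) (kform (burns m) opposite x) u v w)"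
    using linear_lee ext_deriv_kform_opposite[OF assms] by blast
  fix t assume t: "linear t \<and> (\<forall>u v w. ext_deriv2 (kform (burns m) opposite) x u v w = 2 * wedge12 t (kform (burns m) opposite x) u v w)"
  have "linear (\<lambda>u. t u - lee m x u)" using t linear_lee by (intro linear_compose_sub) auto
  moreover have "wedge12 (\<lambda>u. t u - lee m x u) (kform (burns m) opposite x) u v w = 0" for u v w
  proof -
    have "wedge12 t (kform (burns m) opposite x) u v w = wedge12 (lee m x) (kform (burns m) opposite x) u v w"
      using t ext_deriv_kform_opposite[OF assms, of x u v w] by (metis mult_cancel_left zero_neq_numeral)
    then show ?thesis by (simp add: wedge12_def algebra_simps)
  qed
  ultimately have "t u - lee m x u = 0" for u by (rule wedge_kform_opposite_injective[OF assms])
  then show "t = lee m x" by (simp add: fun_eq_iff)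
qed

lemma lee_field_burns:
  assumes "m > 0" shows "lee_field (burns m) opposite x = (fst x / radial m x, 0)"
  unfolding lee_field_def lee_form_burns[OF assms] sharp_def
proof (rule the_equality)
  have "burns m x (fst x / radial m x, 0) w = lee m x w" for w
  proof -
    have "fst x / radial m x = of_real (1 / Re (radial m x)) * fst x" by (simp add: radial_real)
    then show ?thesis by (simp add: burns_adapted lee_def algebra_simps add_divide_distrib del: of_real_divide)
  qed
  then show *: "\<forall>w. burns m x (fst x / radial m x, 0) w = lee m x w" by blast
  fix t assume "\<forall>w. burns m x t w = lee m x w"
  then show "t = (fst x / radial m x, 0)" using * by (intro burns_nondegenerate[OF assms, of x]) metis
qed

lemma span_vertical:
  assumes "c \<noteq> 0" shows "span {(c, 0), (\<i> * c, 0)} = vertical"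
proof (intro equalityI subsetI)
  fix v :: C2 assume "v \<in> span {(c, 0), (\<i> * c, 0)}"
  moreover have "subspace vertical" by (auto simp: vertical_def subspace_def)
  ultimately show "v \<in> vertical" using span_minimal[of "{(c, 0), (\<i> * c, 0)}" vertical] by (auto simp: vertical_def)
next
  fix v assume v: "v \<in> vertical"
  have "fst v = of_real (Re (fst v / c)) * c + of_real (Im (fst v / c)) * (\<i> * c)"
    using assms complex_eq[of "fst v / c"] by (metis (no_types, lifting) mult.assoc mult.commute distrib_right nonzero_divide_eq_eq)
  then have "v = Re (fst v / c) *\<^sub>R (c, 0) + Im (fst v / c) *\<^sub>R (\<i> * c, 0)"
    using v by (simp add: prod_eq_iff vertical_def scaleR_conv_of_real)
  also have "\<dots> \<in> span {(c, 0), (\<i> * c, 0)}"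
    by (intro span_add span_scale span_base) auto
  finally show "v \<in> span {(c, 0), (\<i> * c, 0)}" .
qed

lemma lee_distribution:
  assumes "m > 0" "fst x \<noteq> 0"
  shows "span {lee_field (burns m) opposite x, opposite x (lee_field (burns m) opposite x)} = vertical"
  unfolding lee_field_burns[OF assms(1)] opposite_vertical
  by (rule span_vertical) (simp add: assms radial_nz)

section \<open>The conformal Kaehler metric\<close>

lemma riemannian_on_conformal:
  assumes "open S" "riemannian_on S g" "smooth_on S c" "\<And>x. x \<in> S \<Longrightarrow> c x > 0"
  shows "riemannian_on S (\<lambda>x u v. c x * g x u v)"
proof -
  have "linear (\<lambda>v. c x * g x u v)" if "linear (g x u)" for x u
    using linear_compose[OF that linear_times[of "c x"]] by (simp add: comp_def)
  then show ?thesis using assms unfolding riemannian_on_def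
    by (auto intro!: smooth_on_mult)
qed

lemma ext_deriv2_conformal:
  assumes "\<And>u v. (\<lambda>y. \<omega> y u v) differentiable (at x)" "(c has_derivative c') (at x)"
  shows "ext_deriv2 (\<lambda>y u v. c y * \<omega> y u v) x u v w = c x * ext_deriv2 \<omega> x u v w + wedge12 c' (\<omega> x) u v w"
proof -
  have "pderivative (\<lambda>y. c y * \<omega> y v w) x u = c x * pderivative (\<lambda>y. \<omega> y v w) x u + c' u * \<omega> x v w" for u v w
  proof -
    have "((\<lambda>y. \<omega> y v w) has_derivative frechet_derivative (\<lambda>y. \<omega> y v w) (at x)) (at x)"
      using assms(1) by (simp add: frechet_derivative_works)
    from pderivativeI[OF has_derivative_mult[OF assms(2) this]] show ?thesis
      by (simp add: pderivative_def)
  qed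
  then show ?thesis by (simp add: ext_deriv2_def wedge12_def algebra_simps)
qed

text \<open>\<open>d (P\<^sup>-\<^sup>2 \<omega>\<^sub>I) = P\<^sup>-\<^sup>2 (2 \<theta> - 2 d ln P) \<and> \<omega>\<^sub>I = 0\<close>.\<close>

lemma conformal_kahler_burns:
  assumes "m > 0" "open S"
  shows "kahler_on S (\<lambda>y u v. exp (- 2 * ln (Re (radial m y))) * burns m y u v) opposite"
proof -
  define c where "c = (\<lambda>y. inverse ((Re (radial m y))\<^sup>2))"
  have pos: "Re (radial m y) > 0" for y by (rule radial_pos[OF assms(1)])
  have nz: "Re (radial m y) \<noteq> 0" for y using pos[of y] by simp
  have c: "exp (- 2 * ln (Re (radial m y))) = c y" for y
    using pos[of y] exp_double[of "ln (Re (radial m y))"] by (simp add: c_def exp_minus)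
  have "smooth_on S c" unfolding c_def using nz by (intro smooth_intros assms) auto
  moreover have "c y > 0" for y using nz by (simp add: c_def)
  ultimately have R: "riemannian_on S (\<lambda>y u v. c y * burns m y u v)"
    by (intro riemannian_on_conformal riemannian_burns assms)
  have "ext_deriv2 (kform (\<lambda>y u v. c y * burns m y u v) opposite) x u v w = 0" for x u v w
  proof -
    have c': "(c has_derivative (\<lambda>u. - 2 * c x * lee m x u)) (at x)"
    proof (rule has_derivative_eq_rhs)
      let ?r = "Re (radial m x)" and ?d = "\<lambda>u. 2 * Re (line_sq x) * Re (cnj (fst x) * vert x u)"
      show "(c has_derivative (\<lambda>u. - (inverse (?r * ?r) * (?r * ?d u + ?d u * ?r) * inverse (?r * ?r)))) (at x)"
        unfolding c_def power2_eq_square using nz[of x]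
        by (intro Deriv.has_derivative_inverse has_derivative_mult Re_radial_has_derivative) auto
      have "- (inverse (r * r) * (r * d + d * r) * inverse (r * r)) = - 2 * inverse (r\<^sup>2) * (d / r)"
        if "r \<noteq> 0" for r d :: real
        using that by (simp add: divide_simps power2_eq_square)
      then show "(\<lambda>u. - (inverse (?r * ?r) * (?r * ?d u + ?d u * ?r) * inverse (?r * ?r))) =
          (\<lambda>u. - 2 * c x * lee m x u)"
        unfolding c_def lee_def using nz[of x] by (intro ext) blast
    qed
    have k: "kform (\<lambda>y u v. c y * burns m y u v) opposite = (\<lambda>y u v. c y * kform (burns m) opposite y u v)"
      by (simp add: kform_def fun_eq_iff)
    have "(\<lambda>y. kform (burns m) opposite y u v) differentiable (at x)" for u v
      using kform_opposite_has_derivative unfolding differentiable_def by blast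
    then have "ext_deriv2 (kform (\<lambda>y u v. c y * burns m y u v) opposite) x u v w =
       c x * ext_deriv2 (kform (burns m) opposite) x u v w
       + wedge12 (\<lambda>u. - 2 * c x * lee m x u) (kform (burns m) opposite x) u v w"
      unfolding k by (rule ext_deriv2_conformal[OF _ c'])
    then show ?thesis unfolding ext_deriv_kform_opposite[OF assms(1)] by (simp add: wedge12_def algebra_simps)
  qed
  then show ?thesis
    using R almost_complex_opposite[OF assms(2)] burns_opposite nijenhuis_opposite
    unfolding c kahler_on_def hermitian_on_def by auto
qed

lemma locally_conf_kahler_burns:
  assumes "m > 0" "open S" shows "locally_conf_kahler_on S (burns m) opposite"
  unfolding locally_conf_kahler_on_def
proof
  fix x assume "x \<in> S"
  have "smooth_on S (\<lambda>y. - 2 * ln (Re (radial m y)))"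
    by (intro smooth_intros assms radial_pos)
  then show "\<exists>W f. open W \<and> x \<in> W \<and> W \<subseteq> S \<and> smooth_on W f \<and>
      kahler_on W (\<lambda>y u v. exp (f y) * burns m y u v) opposite"
    using conformal_kahler_burns[OF assms] \<open>x \<in> S\<close> assms(2) by blast
qed

section \<open>The Burns metric is of Calabi type\<close>

lemma dim_vertical: "dim vertical = 2"
proof -
  have "vertical = (\<lambda>c. (c, 0)) ` (UNIV :: complex set)" by (auto simp: vertical_def)
  moreover have "dim ((\<lambda>c. (c, 0 :: complex)) ` (UNIV :: complex set)) = dim (UNIV :: complex set)"
    by (intro dim_image_eq linearI inj_onI) auto
  ultimately show ?thesis by simp
qed

lemma rank2_distribution_vertical: "rank2_distribution blowup (\<lambda>_ _. vertical)"
  unfolding rank2_distribution_def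
proof (intro conjI ballI)
  fix i :: bool
  have "open (UNIV :: C2 set)" "smooth_on (UNIV :: C2 set) (\<lambda>_. (1, 0) :: C2)" "smooth_on (UNIV :: C2 set) (\<lambda>_. (\<i>, 0) :: C2)"
    "span {(1, 0), (\<i>, 0)} = vertical"
    using span_vertical[of 1] by (auto intro: smooth_intros)
  then show "rank2_distribution_on (cdom blowup i) (\<lambda>_. vertical)"
    unfolding rank2_distribution_on_def
    by (metis UNIV_I dim_vertical subset_UNIV blowup_simps(3) subspace_span)
next
  fix i j x assume x: "x \<in> overlap blowup i j"
  show "vertical = dtransition blowup i j x ` vertical"
  proof (cases "i = j")
    case True
    then show ?thesis by (simp add: dtransition_blowup_self image_def)
  next
    case False
    then have nz: "snd x \<noteq> 0" using x by (simp add: overlap_blowup)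
    have "v \<in> dtransition blowup i j x ` vertical" if "v \<in> vertical" for v
      using that nz by (intro image_eqI[of _ _ "(fst v / snd x, 0)"])
        (auto simp: vertical_def dtransition_blowup[OF False nz] prod_eq_iff)
    moreover have "dtransition blowup i j x v \<in> vertical" if "v \<in> vertical" for v
      using that by (simp add: vertical_def dtransition_blowup[OF False nz])
    ultimately show ?thesis by blast
  qed
qed

lemma qch_distribution_vertical:
  assumes "m > 0"
  shows "qch_distribution blowup (\<lambda>_. burns m) blowup_J (\<lambda>_ _. vertical)"
  unfolding qch_distribution_def
proof (intro conjI ballI)
  show "rank2_distribution blowup (\<lambda>_ _. vertical)" by (rule rank2_distribution_vertical)
next
  fix i :: bool and x
  show "blowup_J i x ` vertical \<subseteq> vertical"
    by (auto simp: blowup_J_def J_std_def cscale_def vertical_def)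
next
  fix i :: bool and x
  let ?\<phi> = "\<lambda>r. 2 * m / (Re (radial m x))\<^sup>2 * ((1 - r\<^sup>2)\<^sup>2 - 2 * r\<^sup>2 * (1 - r\<^sup>2))"
  have "hol_curv (burns m) J_std x u = ?\<phi> (sqrt (burns m x (orth_proj (burns m x) vertical u) (orth_proj (burns m x) vertical u)))"
    if "burns m x u u = 1" for u
  proof -
    have "burns m x (orth_proj (burns m x) vertical u) (orth_proj (burns m x) vertical u)
        = 2 * Re (line_sq x) * (cmod (vert x u))\<^sup>2"
      unfolding orth_proj_vertical burns_self by simp
    moreover have "\<dots> \<ge> 0" using line_sq_pos[of x] by simp
    ultimately show ?thesis using hol_curv_burns[OF assms that refl] by simp
  qed
  then show "\<exists>\<phi>::real \<Rightarrow> real. \<forall>u. burns m x u u = 1 \<longrightarrow> hol_curv (burns m) (blowup_J i) x u =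
     \<phi> (sqrt (burns m x (orth_proj (burns m x) vertical u) (orth_proj (burns m x) vertical u)))"
    unfolding blowup_J_def by (intro exI[of _ ?\<phi>]) blast
qed

lemma kahler_surface_burns:
  assumes "m > 0" shows "kahler_surface blowup (\<lambda>_. burns m) blowup_J"
  unfolding kahler_surface_def
  using smooth_manifold_blowup riemannian_metric_burns[OF assms] endo_field_J kahler_burns[OF assms]
  by (auto simp: blowup_simps blowup_J_def)

text \<open>The complement of the exceptional divisor: there the Lee form and \<open>\<nabla>I\<close> have no zeros.\<close>

definition off_divisor :: "(C2 \<times> C2 set) set" where
  "off_divisor = {p \<in> pts blowup. fst p \<noteq> 0}"

lemma cpar_off_divisor: "cpar blowup i x \<in> off_divisor \<longleftrightarrow> fst x \<noteq> 0"
proof -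
  have "cpar blowup i x \<in> pts blowup" by (auto simp: pts_blowup_eq)
  then show ?thesis using blow_down_eq_0_iff[of i x] by (simp add: off_divisor_def blow_down_def)
qed

lemma openin_off_divisor: "openin (atlas_topology blowup) off_divisor"
  using open_fst_neq_0 by (auto simp: openin_atlas_topology cpar_off_divisor blowup_simps(2,3))
    (auto simp: off_divisor_def)

lemma dense_off_divisor: "(atlas_topology blowup) closure_of off_divisor = pts blowup"
proof
  have "openin (atlas_topology blowup) (pts blowup)"
  proof -
    have "cpar blowup i x \<in> pts blowup" for i x by (auto simp: pts_blowup_eq)
    then show ?thesis by (simp add: openin_atlas_topology blowup_simps(3))
  qed
  then have top: "topspace (atlas_topology blowup) = pts blowup"
    by (simp add: openin_atlas_topology openin_subset subset_antisym
        openin_topspace[of "atlas_topology blowup", unfolded openin_atlas_topology])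
  show "(atlas_topology blowup) closure_of off_divisor \<subseteq> pts blowup"
    using closure_of_subset_topspace top by metis
  show "pts blowup \<subseteq> (atlas_topology blowup) closure_of off_divisor"
  proof
    fix p assume p: "p \<in> pts blowup"
    have "\<exists>q. q \<in> off_divisor \<and> q \<in> T" if T: "p \<in> T" "openin (atlas_topology blowup) T" for T
    proof -
      obtain i x where x: "p = cpar blowup i x" using p by (auto simp: pts_blowup_eq)
      have "open {y. cpar blowup i y \<in> T}"
        using openin_chart_preimage[OF T(2), of i] by (simp add: blowup_simps)
      moreover have "{y. cpar blowup i y \<in> T} \<noteq> {}" using x T(1) by blast
      ultimately obtain y where "cpar blowup i y \<in> T" "fst y \<noteq> 0" using dense_fst_neq_0 by blast
      then show ?thesis using cpar_off_divisor by blast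
    qed
    then show "p \<in> (atlas_topology blowup) closure_of off_divisor"
      using p top unfolding in_closure_of by blast
  qed
qed

lemma calabi_type_burns:
  assumes m: "m > 0"
  shows "calabi_type_kahler_surface (restrict_atlas blowup off_divisor) (\<lambda>_. burns m) blowup_J"
  unfolding calabi_type_kahler_surface_def
proof (intro conjI exI[of _ "\<lambda>_ _. vertical"] ballI)
  have dom: "cdom (restrict_atlas blowup off_divisor) i = {x. fst x \<noteq> 0}" for i
    by (simp add: restrict_atlas_simps cpar_off_divisor blowup_simps(3))
  show "kahler_surface (restrict_atlas blowup off_divisor) (\<lambda>_. burns m) blowup_J"
    by (rule kahler_surface_restrict[OF kahler_surface_burns[OF m] openin_off_divisor])
  show "qch_distribution (restrict_atlas blowup off_divisor) (\<lambda>_. burns m) blowup_J (\<lambda>_ _. vertical)"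
    by (rule qch_distribution_restrict[OF smooth_manifold_blowup qch_distribution_vertical[OF m] openin_off_divisor])
  show "generalized_calabi (restrict_atlas blowup off_divisor) (\<lambda>_. burns m) blowup_J (\<lambda>_ _. vertical)"
    unfolding generalized_calabi_def blowup_J_def opposite_structure_burns Let_def dom
    using hermitian_opposite[OF m open_fst_neq_0] norm_cov_deriv_opposite_pos[OF m] lee_distribution[OF m]
      parallel_directions[OF m] by simp
  fix i
  show "locally_conf_kahler_on (cdom (restrict_atlas blowup off_divisor) i) (burns m)
      (opposite_structure (burns m) (blowup_J i) (\<lambda>_. vertical))"
    unfolding dom blowup_J_def opposite_structure_burns
    by (rule locally_conf_kahler_burns[OF m open_fst_neq_0])
qed

theorem theorem6p1:
  fixes m :: real
  assumes "m > 0"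
  shows "(\<exists>!g. burns_metric m g) \<and>
         (\<forall>g. burns_metric m g \<longrightarrow> qch_kahler_surface_of_calabi_type blowup g blowup_J)"
proof (intro conjI allI impI)
  show "\<exists>!g. burns_metric m g"
    using burns_metric_burns[OF assms] burns_metric_unique[OF assms] by blast
  fix g assume "burns_metric m g"
  then have g: "g = (\<lambda>_. burns m)" by (rule burns_metric_unique[OF assms])
  show "qch_kahler_surface_of_calabi_type blowup g blowup_J"
    unfolding g qch_kahler_surface_of_calabi_type_def qch_kahler_surface_def
    using kahler_surface_burns[OF assms] qch_distribution_vertical[OF assms]
      openin_off_divisor dense_off_divisor calabi_type_burns[OF assms] by blast
qed

end
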